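(* Let $(\Sigma,m)$ be a weighted simplicial complex and let $\Delta^H$ be the Hodge Laplacian associated to a closed quadratic form $Q^H$ with $Q^H_D\subseteq Q^H\subseteq Q^H_N$. Assume that for all $\rho\in\Sigma$ the connected components of the graph $b_\rho$ over $\mathrm{lk}(\rho)$ are recurrent and that $\partial\delta C_c(\Sigma)\subseteq\ell^2(\Sigma,m)$. Then, on $D(\Delta^H)$, $$\Delta^H=\partial\delta+\delta\partial,$$ i.e. for every $\omega\in D(\Delta^H)$ the expression $\partial\delta\omega+\delta\partial\omega$ is well defined and equals $\Delta^H\omega$.
   Context: Weighted simplicial complexes. Let $X$ be a set (of vertices). A simplicial complex $\hat\Sigma$ over $X$ is a (non-empty) set of finite subsets of $X$ closed under taking subsets, whose $0$-simplices are identified with $X$; it contains $\varnothing$. A simplex with $k+1$ elements has dimension $k$. Write $\tau\prec\sigma$ (or $\sigma\succ\tau$) if $\tau\subseteq\sigma$ and $|\sigma\setminus\tau|=1$; then $\tau$ is a face of $\sigma$ and $\sigma$ a coface of $\tau$. Let $m:\hat\Sigma\to(0,\infty)$. Put $\Sigma=\hat\Sigma$ if $\sum_{x\in X}m(x)<\infty$ and $\Sigma=\hat\Sigma\setminus\{\varnothing\}$ otherwise. Assume $m$ is locally summable: $\sum_{\sigma\succ\tau}m(\sigma)<\infty$ for all $\tau\in\Sigma$. Then $(\Sigma,m)$ is called a weighted simplicial complex; no local finiteness is assumed. All simplices below range over $\Sigma$. $C(\Sigma)$ denotes the complex functions on $\Sigma$, $C_c(\Sigma)$ those of finite support, and $\ell^2=\ell^2(\Sigma,m)$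 is the Hilbert space with inner product $\langle f,g\rangle=\sum_{\tau\in\Sigma} m(\tau)f(\tau)\overline{g(\tau)}$ and norm $\|\cdot\|_2$. Coboundary and boundary. Fix a coboundary operator, i.e. a linear operator $\delta:C(\Sigma)\to C(\Sigma)$ of the form $\delta\omega(\sigma)=\sum_{\tau\prec\sigma}\theta(\tau,\sigma)\omega(\tau)$ (a finite sum) with $\theta(\tau,\sigma)=\delta 1_\tau(\sigma)\in\{\pm1\}$ for $\tau\prec\sigma$, satisfying $\delta\delta=0$. The boundary operator $\partial:D(\partial)\to C(\Sigma)$ is $$\partial\omega(\rho)=\frac1{m(\rho)}\sum_{\tau\succ\rho}m(\tau)\theta(\rho,\tau)\omega(\tau),\qquad D(\partial)=\Big\{\omega\in C(\Sigma):\sum_{\tau\succ\rho}m(\tau)|\omega(\tau)|<\infty\text{ for all }\rho\in\Sigma\Big\}.$$ One has $\ell^2\subseteq D(\partial)$ and, by local summability, $\delta C_c(\Sigma)\subseteq\ell^2$. Hodge forms. Let $\mathcal Q^H:D(\partial)\to[0,\infty]$, $\mathcal Q^H(\omega)=\sum_{\Sigma}m|\delta\omega+\partial\omega|^2$. $Q^H_N$ is the restriction of $\mathcal Q^H$ to $D(Q^H_N)=\{\omega\in\ell^2:\mathcal Q^H(\omega)<\infty\}$, and $Q^H_D$ is the restriction of $\mathcal Q^H$ to $D(Q^H_D)=\{\omega\in\ell^2:\lim_n(\|\omega_n-\omega\|_2^2+\mathcal Q^H(\omega_n-\omega))=0\text{ for some }\omega_n\in C_c(\Sigma)\}$. Both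 are closed forms on $\ell^2$. $Q^H_D\subseteq Q^H\subseteq Q^H_N$ means that $Q^H$ is the restriction of $\mathcal Q^H$ to a subspace $D(Q^H)$ with $D(Q^H_D)\subseteq D(Q^H)\subseteq D(Q^H_N)$. The Hodge Laplacian $\Delta^H$ of a closed such form is the unique positive self-adjoint operator on $\ell^2$ with $D(\Delta^H)\subseteq D(Q^H)$ associated to $Q^H$, so that $Q^H(\omega,\eta)=\langle\Delta^H\omega,\eta\rangle$ for all $\omega\in D(\Delta^H)$, $\eta\in D(Q^H)$, where $Q^H(\cdot,\cdot)$ is the sesquilinear form obtained by polarization. Links. For $\rho\in\Sigma$, $\mathrm{lk}(\rho)=\{v\in X: v\cup\rho\in\Sigma,\ v\cup\rho\succ\rho\}$ (identifying the vertex $v$ with $\{v\}$), with $v\rho=v\cup\rho$ and $vv'\rho=v\cup v'\cup\rho$. The link graph is the symmetric function $b_\rho:\mathrm{lk}(\rho)\times\mathrm{lk}(\rho)\to[0,\infty)$, $b_\rho(v,v')=m(vv'\rho)$ if $v\ne v'$ and $vv'\rho\in\Sigma$, and $b_\rho(v,v')=0$ otherwise. Local summability gives $\sum_{v'}b_\rho(v,v')<\infty$ for all $v\in\mathrm{lk}(\rho)$. Connected components are the classes of vertices joined by finite paths along which $b_\rho>0$. Recurrence. A connected graph $b$ over $X$ is recurrent if the Markov chain $(Y_n)$ with transition probabilities $\mathbb P(Y_n=y\mid Y_{n-1}=x)=b(x,y)/\sum_z b(x,z)$ satisfies $\mathbb P(Y_k=y\text{ for some }k>0\mid Y_0=x)=1$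 for all $x,y$; equivalently, the constant function $1$ is a pointwise limit of finitely supported functions $\varphi_n$ with $\frac12\sum_{x,y}b(x,y)|\varphi_n(x)-\varphi_n(y)|^2\to0$. A component consisting of a single vertex counts as recurrent. *)

theory Defs
  imports "HOL-Probability.Probability" "HOL-Library.Function_Algebras"
begin

section \<open>Weighted simplicial complexes\<close>

definition simplicial_complex :: "'v set \<Rightarrow> 'v set set \<Rightarrow> bool" where
  "simplicial_complex X K \<longleftrightarrow>
     K \<noteq> {} \<and>
     (\<forall>\<sigma>\<in>K. finite \<sigma> \<and> \<sigma> \<subseteq> X) \<and>
     (\<forall>\<sigma>\<in>K. \<forall>\<tau>. \<tau> \<subseteq> \<sigma> \<longrightarrow> \<tau> \<in> K) \<and>
     (\<forall>x\<in>X. {x} \<in> K)"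

definition is_face :: "'v set \<Rightarrow> 'v set \<Rightarrow> bool" (infix "\<prec>\<^sub>f" 50) where
  "\<tau> \<prec>\<^sub>f \<sigma> \<longleftrightarrow> \<tau> \<subseteq> \<sigma> \<and> card (\<sigma> - \<tau>) = 1"

definition faces :: "'v set set \<Rightarrow> 'v set \<Rightarrow> 'v set set" where
  "faces S \<sigma> = {\<tau>\<in>S. \<tau> \<prec>\<^sub>f \<sigma>}"

definition cofaces :: "'v set set \<Rightarrow> 'v set \<Rightarrow> 'v set set" where
  "cofaces S \<tau> = {\<sigma>\<in>S. \<tau> \<prec>\<^sub>f \<sigma>}"

text \<open>
  The set \<open>S\<close> is obtained from a simplicial complex \<open>K\<close> over \<open>X\<close> by keeping the empty simplex
  exactly if the total vertex weight is finite. There is no local finiteness or countability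
  assumption, so all infinite sums are unordered (\<open>summable_on\<close>, \<open>infsum\<close>).
\<close>

definition weighted_simplicial_complex ::
    "'v set \<Rightarrow> 'v set set \<Rightarrow> ('v set \<Rightarrow> real) \<Rightarrow> bool" where
  "weighted_simplicial_complex X S m \<longleftrightarrow>
     (\<exists>K. simplicial_complex X K \<and>
          (\<forall>\<sigma>\<in>K. 0 < m \<sigma>) \<and>
          S = (if (\<lambda>x. m {x}) summable_on X then K else K - {{}})) \<and>
     (\<forall>\<tau>\<in>S. m summable_on cofaces S \<tau>)"

section \<open>Function spaces\<close>

text \<open>
  A complex function on \<open>S\<close> is represented by its extension by zero to the whole type, so
  that equality of functions on \<open>S\<close> is equality in HOL.
\<close>

definition fun_on :: "'a set \<Rightarrow> ('a \<Rightarrow> complex) set" where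
  "fun_on S = {\<omega>. \<forall>\<sigma>. \<sigma> \<notin> S \<longrightarrow> \<omega> \<sigma> = 0}"

definition fun_fin :: "'a set \<Rightarrow> ('a \<Rightarrow> complex) set" where
  "fun_fin S = {\<omega>\<in>fun_on S. finite {\<sigma>. \<omega> \<sigma> \<noteq> 0}}"

definition cscale :: "complex \<Rightarrow> ('a \<Rightarrow> complex) \<Rightarrow> 'a \<Rightarrow> complex" where
  "cscale c \<omega> = (\<lambda>\<sigma>. c * \<omega> \<sigma>)"

global_interpretation cfun: vector_space cscale
  by unfold_locales (auto simp: cscale_def fun_eq_iff algebra_simps)

definition l2 :: "'a set \<Rightarrow> ('a \<Rightarrow> real) \<Rightarrow> ('a \<Rightarrow> complex) set" where
  "l2 S m = {\<omega>\<in>fun_on S. (\<lambda>\<sigma>. m \<sigma> * (cmod (\<omega> \<sigma>))\<^sup>2) summable_on S}"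

definition l2_inner ::
    "'a set \<Rightarrow> ('a \<Rightarrow> real) \<Rightarrow> ('a \<Rightarrow> complex) \<Rightarrow> ('a \<Rightarrow> complex) \<Rightarrow> complex" where
  "l2_inner S m f g = (\<Sum>\<^sub>\<infinity>\<sigma>\<in>S. of_real (m \<sigma>) * f \<sigma> * cnj (g \<sigma>))"

definition l2_norm :: "'a set \<Rightarrow> ('a \<Rightarrow> real) \<Rightarrow> ('a \<Rightarrow> complex) \<Rightarrow> real" where
  "l2_norm S m f = sqrt (\<Sum>\<^sub>\<infinity>\<sigma>\<in>S. m \<sigma> * (cmod (f \<sigma>))\<^sup>2)"

section \<open>Coboundary and boundary\<close>

type_synonym 'v cochain = "'v set \<Rightarrow> complex"

definition coeff_of :: "('v cochain \<Rightarrow> 'v cochain) \<Rightarrow> 'v set \<Rightarrow> 'v set \<Rightarrow> complex" where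
  "coeff_of \<delta> \<tau> \<sigma> = \<delta> (indicator {\<tau>}) \<sigma>"

text \<open>Linearity on \<open>fun_on S\<close> is implied by the second conjunct.\<close>

definition coboundary_operator ::
    "'v set set \<Rightarrow> ('v cochain \<Rightarrow> 'v cochain) \<Rightarrow> bool" where
  "coboundary_operator S \<delta> \<longleftrightarrow>
     (\<forall>\<omega>\<in>fun_on S. \<delta> \<omega> \<in> fun_on S) \<and>
     (\<forall>\<omega>\<in>fun_on S. \<forall>\<sigma>\<in>S. \<delta> \<omega> \<sigma> = (\<Sum>\<tau>\<in>faces S \<sigma>. coeff_of \<delta> \<tau> \<sigma> * \<omega> \<tau>)) \<and>
     (\<forall>\<tau>\<in>S. \<forall>\<sigma>\<in>S. \<tau> \<prec>\<^sub>f \<sigma> \<longrightarrow> coeff_of \<delta> \<tau> \<sigma> \<in> {1, -1}) \<and>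
     (\<forall>\<omega>\<in>fun_on S. \<delta> (\<delta> \<omega>) = 0)"

definition boundary_dom :: "'v set set \<Rightarrow> ('v set \<Rightarrow> real) \<Rightarrow> 'v cochain set" where
  "boundary_dom S m =
     {\<omega>\<in>fun_on S. \<forall>\<rho>\<in>S. (\<lambda>\<tau>. m \<tau> * cmod (\<omega> \<tau>)) summable_on cofaces S \<rho>}"

definition boundary ::
    "'v set set \<Rightarrow> ('v set \<Rightarrow> real) \<Rightarrow> ('v cochain \<Rightarrow> 'v cochain) \<Rightarrow> 'v cochain \<Rightarrow> 'v cochain" where
  "boundary S m \<delta> \<omega> = (\<lambda>\<rho>.
     if \<rho> \<in> S
     then 1 / of_real (m \<rho>) * (\<Sum>\<^sub>\<infinity>\<tau>\<in>cofaces S \<rho>. of_real (m \<tau>) * coeff_of \<delta> \<rho> \<tau> * \<omega> \<tau>)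
     else 0)"

section \<open>Hodge forms\<close>

definition hodge_form ::
    "'v set set \<Rightarrow> ('v set \<Rightarrow> real) \<Rightarrow> ('v cochain \<Rightarrow> 'v cochain) \<Rightarrow> 'v cochain \<Rightarrow> ennreal" where
  "hodge_form S m \<delta> \<omega> =
     (\<Sum>\<^sub>\<infinity>\<sigma>\<in>S. ennreal (m \<sigma> * (cmod (\<delta> \<omega> \<sigma> + boundary S m \<delta> \<omega> \<sigma>))\<^sup>2))"

text \<open>The square of the form norm.\<close>

definition hodge_form_norm2 ::
    "'v set set \<Rightarrow> ('v set \<Rightarrow> real) \<Rightarrow> ('v cochain \<Rightarrow> 'v cochain) \<Rightarrow> 'v cochain \<Rightarrow> ennreal" where
  "hodge_form_norm2 S m \<delta> \<omega> = ennreal ((l2_norm S m \<omega>)\<^sup>2) + hodge_form S m \<delta> \<omega>"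

definition hodge_dom_N ::
    "'v set set \<Rightarrow> ('v set \<Rightarrow> real) \<Rightarrow> ('v cochain \<Rightarrow> 'v cochain) \<Rightarrow> 'v cochain set" where
  "hodge_dom_N S m \<delta> = {\<omega>\<in>l2 S m. hodge_form S m \<delta> \<omega> < \<infinity>}"

definition hodge_dom_D ::
    "'v set set \<Rightarrow> ('v set \<Rightarrow> real) \<Rightarrow> ('v cochain \<Rightarrow> 'v cochain) \<Rightarrow> 'v cochain set" where
  "hodge_dom_D S m \<delta> =
     {\<omega>\<in>l2 S m. \<exists>u. (\<forall>n. u n \<in> fun_fin S) \<and>
        (\<lambda>n::nat. hodge_form_norm2 S m \<delta> (u n - \<omega>)) \<longlonglongrightarrow> 0}"

text \<open>
  A form between the Dirichlet and the Neumann form is determined by its domain \<open>DQ\<close>; it is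
  closed if \<open>DQ\<close> is complete with respect to the form norm.
\<close>

definition closed_hodge_form ::
    "'v set set \<Rightarrow> ('v set \<Rightarrow> real) \<Rightarrow> ('v cochain \<Rightarrow> 'v cochain) \<Rightarrow> 'v cochain set \<Rightarrow> bool" where
  "closed_hodge_form S m \<delta> DQ \<longleftrightarrow>
     cfun.subspace DQ \<and> hodge_dom_D S m \<delta> \<subseteq> DQ \<and> DQ \<subseteq> hodge_dom_N S m \<delta> \<and>
     (\<forall>u::nat \<Rightarrow> 'v cochain.
        (\<forall>n. u n \<in> DQ) \<and>
        (\<forall>e>0. \<exists>N. \<forall>i\<ge>N. \<forall>j\<ge>N. hodge_form_norm2 S m \<delta> (u i - u j) < ennreal e) \<longrightarrow>
        (\<exists>\<omega>\<in>DQ. (\<lambda>n. hodge_form_norm2 S m \<delta> (u n - \<omega>)) \<longlonglongrightarrow> 0))"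

text \<open>Polarization, with the convention that forms are linear in the first argument.\<close>

definition polarize ::
    "(('a \<Rightarrow> complex) \<Rightarrow> real) \<Rightarrow> ('a \<Rightarrow> complex) \<Rightarrow> ('a \<Rightarrow> complex) \<Rightarrow> complex" where
  "polarize q \<omega> \<eta> =
     (of_real (q (\<omega> + \<eta>)) - of_real (q (\<omega> - \<eta>))
      + \<i> * of_real (q (\<omega> + cscale \<i> \<eta>)) - \<i> * of_real (q (\<omega> - cscale \<i> \<eta>))) / 4"

definition hodge_sesq ::
    "'v set set \<Rightarrow> ('v set \<Rightarrow> real) \<Rightarrow> ('v cochain \<Rightarrow> 'v cochain) \<Rightarrow>
     'v cochain \<Rightarrow> 'v cochain \<Rightarrow> complex" where
  "hodge_sesq S m \<delta> = polarize (\<lambda>\<omega>. enn2real (hodge_form S m \<delta> \<omega>))"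

section \<open>Positive self-adjoint operators and the Hodge Laplacian\<close>

text \<open>
  An unbounded operator on \<open>l2 S m\<close> is a domain \<open>D\<close> together with a map \<open>A\<close>, of which only the
  values on \<open>D\<close> matter. The last conjunct of \<open>self_adjoint_on\<close> says that the graph of the adjoint
  of \<open>A\<close> is the graph of \<open>A\<close>.
\<close>

definition linear_operator_on ::
    "'a set \<Rightarrow> ('a \<Rightarrow> real) \<Rightarrow> ('a \<Rightarrow> complex) set \<Rightarrow> (('a \<Rightarrow> complex) \<Rightarrow> 'a \<Rightarrow> complex) \<Rightarrow> bool"
  where
  "linear_operator_on S m D A \<longleftrightarrow>
     cfun.subspace D \<and> D \<subseteq> l2 S m \<and> (\<forall>f\<in>D. A f \<in> l2 S m) \<and>
     (\<forall>f\<in>D. \<forall>g\<in>D. A (f + g) = A f + A g) \<and>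
     (\<forall>c. \<forall>f\<in>D. A (cscale c f) = cscale c (A f))"

definition self_adjoint_on ::
    "'a set \<Rightarrow> ('a \<Rightarrow> real) \<Rightarrow> ('a \<Rightarrow> complex) set \<Rightarrow> (('a \<Rightarrow> complex) \<Rightarrow> 'a \<Rightarrow> complex) \<Rightarrow> bool"
  where
  "self_adjoint_on S m D A \<longleftrightarrow>
     linear_operator_on S m D A \<and>
     (\<forall>f\<in>l2 S m. \<forall>e>0. \<exists>g\<in>D. l2_norm S m (f - g) < e) \<and>
     (\<forall>g\<in>l2 S m. \<forall>h\<in>l2 S m.
        (\<forall>f\<in>D. l2_inner S m (A f) g = l2_inner S m f h) \<longleftrightarrow> g \<in> D \<and> h = A g)"

definition positive_on ::
    "'a set \<Rightarrow> ('a \<Rightarrow> real) \<Rightarrow> ('a \<Rightarrow> complex) set \<Rightarrow> (('a \<Rightarrow> complex) \<Rightarrow> 'a \<Rightarrow> complex) \<Rightarrow> bool"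
  where
  "positive_on S m D A \<longleftrightarrow> (\<forall>f\<in>D. l2_inner S m (A f) f \<in> \<real> \<and> 0 \<le> Re (l2_inner S m (A f) f))"

text \<open>
  \<open>(DL, L)\<close> is the operator associated to the form with domain \<open>DQ\<close>. For closed forms it exists
  and is unique as an operator on \<open>DL\<close>.
\<close>

definition hodge_laplacian ::
    "'v set set \<Rightarrow> ('v set \<Rightarrow> real) \<Rightarrow> ('v cochain \<Rightarrow> 'v cochain) \<Rightarrow> 'v cochain set \<Rightarrow>
     'v cochain set \<Rightarrow> ('v cochain \<Rightarrow> 'v cochain) \<Rightarrow> bool" where
  "hodge_laplacian S m \<delta> DQ DL L \<longleftrightarrow>
     self_adjoint_on S m DL L \<and> positive_on S m DL L \<and> DL \<subseteq> DQ \<and>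
     (\<forall>\<omega>\<in>DL. \<forall>\<eta>\<in>DQ. hodge_sesq S m \<delta> \<omega> \<eta> = l2_inner S m (L \<omega>) \<eta>)"

section \<open>Recurrence of graphs\<close>

text \<open>
  A graph over \<open>V\<close> is a symmetric weight \<open>b\<close> with finite vertex degrees \<open>\<Sum>\<^sub>\<infinity>z\<in>V. b x z\<close>.
\<close>

definition transition_prob :: "'v set \<Rightarrow> ('v \<Rightarrow> 'v \<Rightarrow> real) \<Rightarrow> 'v \<Rightarrow> 'v \<Rightarrow> real" where
  "transition_prob V b x y = b x y / (\<Sum>\<^sub>\<infinity>z\<in>V. b x z)"

text \<open>
  \<open>P\<close> is the law on the trajectory space of the Markov chain in \<open>V\<close> with transition
  probabilities \<open>p\<close> started at \<open>x\<close>; the last conjunct is the Markov property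
  together with the one-step transition probabilities, multiplied out in order to avoid
  conditioning on null events.
\<close>

definition markov_chain_law ::
    "'v set \<Rightarrow> ('v \<Rightarrow> 'v \<Rightarrow> real) \<Rightarrow> 'v \<Rightarrow> (nat \<Rightarrow> 'v) measure \<Rightarrow> bool" where
  "markov_chain_law V p x P \<longleftrightarrow>
     prob_space P \<and>
     sets P = sets (Pi\<^sub>M UNIV (\<lambda>_. count_space V)) \<and>
     \<P>(Y in P. Y 0 = x) = 1 \<and>
     (\<forall>n. \<forall>y\<in>UNIV \<rightarrow> V.
        \<P>(Y in P. \<forall>i\<le>Suc n. Y i = y i) =
        \<P>(Y in P. \<forall>i\<le>n. Y i = y i) * p (y n) (y (Suc n)))"

text \<open>
  In a connected graph over \<open>V\<close> with more than one vertex every vertex has positive degree and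
  \<open>V\<close> is countable, so the law exists and is unique for every starting point. A graph with a
  single vertex is recurrent by convention.
\<close>

definition recurrent :: "'v set \<Rightarrow> ('v \<Rightarrow> 'v \<Rightarrow> real) \<Rightarrow> bool" where
  "recurrent V b \<longleftrightarrow>
     (\<exists>v. V = {v}) \<or>
     (\<forall>x\<in>V. \<forall>y\<in>V. \<exists>P. markov_chain_law V (transition_prob V b) x P \<and>
        \<P>(Y in P. \<exists>k>0. Y k = y) = 1)"

definition graph_components :: "'v set \<Rightarrow> ('v \<Rightarrow> 'v \<Rightarrow> real) \<Rightarrow> 'v set set" where
  "graph_components V b =
     V // {(x, y) \<in> V \<times> V. (x, y) \<in> {(v, v') \<in> V \<times> V. 0 < b v v'}\<^sup>*}"

section \<open>Links\<close>

definition link :: "'v set \<Rightarrow> 'v set set \<Rightarrow> 'v set \<Rightarrow> 'v set" where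
  "link X S \<rho> = {v\<in>X. insert v \<rho> \<in> S \<and> \<rho> \<prec>\<^sub>f insert v \<rho>}"

definition link_graph ::
    "'v set set \<Rightarrow> ('v set \<Rightarrow> real) \<Rightarrow> 'v set \<Rightarrow> 'v \<Rightarrow> 'v \<Rightarrow> real" where
  "link_graph S m \<rho> v v' =
     (if v \<noteq> v' \<and> insert v (insert v' \<rho>) \<in> S then m (insert v (insert v' \<rho>)) else 0)"

end

theory Submission
  imports Defs
begin

text \<open>
  Write \<open>D \<omega> = \<delta> \<omega> + \<partial> \<omega>\<close>. A form domain contains the indicator of every simplex \<open>\<tau>\<close>, and testing
  \<open>Q(\<omega>, 1\<^sub>\<tau>) = \<langle>L \<omega>, 1\<^sub>\<tau>\<rangle>\<close> gives \<open>L \<omega> = \<partial> (D \<omega>) + \<delta> (D \<omega>)\<close> pointwise (\<open>hodge_sesq_indicator\<close>), because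
  \<open>D \<omega> \<in> l\<^sup>2\<close> and \<open>D 1\<^sub>\<tau>\<close> lives on the faces and cofaces of \<open>\<tau>\<close>. Since \<open>\<delta> \<delta> = 0\<close>, the second term is
  \<open>\<delta> \<partial> \<omega>\<close>. The first one is \<open>\<partial> \<delta> \<omega>\<close> as soon as \<open>\<partial>\<close> can be applied to the two parts of \<open>D \<omega>\<close> separately
  and \<open>\<partial> \<partial> \<omega> = 0\<close>. Neither is automatic, as without local finiteness all these sums are infinite.

  Separating the two parts uses the hypothesis on \<open>\<partial> \<delta>\<close>. Off \<open>\<tau>\<close>, the function \<open>\<partial> \<delta> 1\<^sub>\<tau>\<close> has absolute
  value \<open>m(\<rho> \<union> \<tau>) / m(\<rho>)\<close> at the simplices \<open>\<rho>\<close> sharing a coface with \<open>\<tau>\<close>, so pairing it with \<open>\<omega> \<in> l\<^sup>2\<close>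
  shows that \<open>m |\<delta> \<omega>|\<close> is summable over the cofaces of \<open>\<tau>\<close> (\<open>coboundary_in_boundary_dom\<close>). As \<open>D \<omega> \<in> l\<^sup>2\<close>,
  the same then holds for \<open>\<partial> \<omega>\<close>.

  The identity \<open>\<partial> \<partial> \<omega> = 0\<close> at \<open>\<tau>\<close> is a statement about flows on the link graph of \<open>\<tau>\<close>
  (\<open>boundary_boundary\<close>). Up to signs \<open>(v, v') \<mapsto> m(vv'\<tau>) \<omega>(vv'\<tau>)\<close> is an antisymmetric flow, its
  divergence at \<open>v\<close> is \<open>m(v\<tau>) \<partial> \<omega>(v\<tau>)\<close>, and \<open>m(\<tau>) \<partial> \<partial> \<omega>(\<tau>)\<close> is the total divergence. The flow has
  finite energy because \<open>\<omega> \<in> l\<^sup>2\<close>, and its divergence was just seen to be summable. On a recurrent graph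
  such a flow loses nothing at infinity (\<open>recurrent_flow_total_divergence\<close>): there are finitely
  supported functions tending pointwise to \<open>1\<close> with energy tending to \<open>0\<close> (\<open>recurrent_cutoff\<close>), and pairing
  the flow with their gradients gives total divergence \<open>0\<close>. These functions are the probabilities of hitting
  a root within a bounded time and inside a finite region.
\<close>

section \<open>Hitting probabilities of a recurrent chain\<close>

text \<open>
  For a chain with transition probabilities \<open>p\<close> this is the probability, started at \<open>x \<in> K\<close>, of visiting
  \<open>r\<close> at one of the times \<open>0, \<dots>, n\<close> without leaving \<open>K\<close> before. Bounding both the time and the region
  gives a function of finite support that is defined by finite sums only.
\<close>

fun hit_within :: "'v set \<Rightarrow> ('v \<Rightarrow> 'v \<Rightarrow> real) \<Rightarrow> 'v \<Rightarrow> nat \<Rightarrow> 'v \<Rightarrow> real" where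
  "hit_within K p r 0 x = (if x = r then 1 else 0)"
| "hit_within K p r (Suc n) x =
     (if x = r then 1 else if x \<in> K then \<Sum>y\<in>K. p x y * hit_within K p r n y else 0)"

lemma hit_within_root [simp]: "hit_within K p r n r = 1"
  by (cases n) auto

lemma hit_within_outside: "r \<in> K \<Longrightarrow> x \<notin> K \<Longrightarrow> hit_within K p r n x = 0"
  by (cases n) auto

lemma hit_within_nonneg:
  assumes "\<And>x y. x \<in> K \<Longrightarrow> y \<in> K \<Longrightarrow> 0 \<le> p x y"
  shows "0 \<le> hit_within K p r n x"
  by (induction n arbitrary: x) (auto intro!: sum_nonneg mult_nonneg_nonneg assms)

lemma hit_within_le_1:
  assumes p: "\<And>x y. x \<in> K \<Longrightarrow> y \<in> K \<Longrightarrow> 0 \<le> p x y" "\<And>x. x \<in> K \<Longrightarrow> (\<Sum>y\<in>K. p x y) \<le> 1"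
  shows "hit_within K p r n x \<le> 1"
proof (induction n arbitrary: x)
  case (Suc n)
  have "(\<Sum>y\<in>K. p x y * hit_within K p r n y) \<le> (\<Sum>y\<in>K. p x y * 1)" if "x \<in> K"
    using Suc that p by (intro sum_mono mult_left_mono) auto
  with p(2)[of x] show ?case by auto
qed auto

text \<open>
  At the points of \<open>K\<close> other than the root this says that \<open>hit_within K p r n\<close> is bounded by its own average over the neighbours
  in \<open>K\<close>. It is this subharmonicity that controls the energy, so the
  true (harmonic) hitting probabilities of \<open>K\<close> need not be constructed.
\<close>

lemma hit_within_mono:
  assumes p: "\<And>x y. x \<in> K \<Longrightarrow> y \<in> K \<Longrightarrow> 0 \<le> p x y"
  shows "hit_within K p r n x \<le> hit_within K p r (Suc n) x"
proof (induction n arbitrary: x)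
  case 0
  then show ?case by (auto intro!: sum_nonneg p)
next
  case (Suc n)
  have "(\<Sum>y\<in>K. p x y * hit_within K p r n y) \<le> (\<Sum>y\<in>K. p x y * hit_within K p r (Suc n) y)" if "x \<in> K"
    using Suc that p by (intro sum_mono mult_left_mono) auto
  then show ?case by auto
qed

lemma markov_chain_law_pred:
  assumes "markov_chain_law V p x P"
  shows "Measurable.pred P (\<lambda>Y. Y j \<in> A)"
proof -
  have s: "sets P = sets (Pi\<^sub>M UNIV (\<lambda>_::nat. count_space V))"
    using assms by (simp add: markov_chain_law_def)
  have "(\<lambda>Y. Y j) \<in> measurable P (count_space V)"
    unfolding measurable_cong_sets[OF s refl] by measurable
  then show ?thesis
    by (rule measurable_compose) simp
qed

lemma markov_chain_law_pred_eq:
  assumes "markov_chain_law V p x P"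
  shows "Measurable.pred P (\<lambda>Y. Y j = a)"
  using markov_chain_law_pred[OF assms, of j "{a}"] by simp

text \<open>
  The law of the chain is only known through its cylinder probabilities, so the Markov property at time \<open>i\<close>
  is replaced by conditioning on a fixed initial path \<open>y 0, \<dots>, y i\<close>: if \<open>y i \<noteq> r\<close>, a trajectory
  that hits \<open>r\<close> inside \<open>K\<close> has its next position in the finite set \<open>K\<close>, and the path can be
  extended by that position.
\<close>

lemma markov_chain_hit_le:
  assumes P: "markov_chain_law V p x P" and K: "finite K" "K \<subseteq> V" "r \<in> K"
    and p: "\<And>x y. x \<in> K \<Longrightarrow> y \<in> K \<Longrightarrow> 0 \<le> p x y"
    and y: "y \<in> UNIV \<rightarrow> V"
  shows "\<P>(Y in P. (\<forall>j\<le>i. Y j = y j) \<and> (\<exists>j\<le>n. Y (i + j) = r \<and> (\<forall>l\<le>j. Y (i + l) \<in> K)))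
       \<le> \<P>(Y in P. \<forall>j\<le>i. Y j = y j) * hit_within K p r n (y i)"
    (is "measure P (?E n i y) \<le> measure P (?C i y) * _")
  using y
proof (induction n arbitrary: i y)
  interpret prob_space P using P by (simp add: markov_chain_law_def)
  note [measurable] = markov_chain_law_pred[OF P] markov_chain_law_pred_eq[OF P]
  have C[measurable]: "?C i y \<in> sets P" for i y by measurable
  have E[measurable]: "?E n i y \<in> sets P" for n i y by measurable
  have triv: "measure P (?E k h z) \<le> measure P (?C h z)" for k h z
    by (rule finite_measure_mono) auto
  {
    case 0
    show ?case
    proof (cases "y i = r")
      case True with triv[of i y 0] show ?thesis by simp
    next
      case False
      then have "?E 0 i y = {}" by auto
      then show ?thesis by (metis (no_types, lifting) hit_within.simps(1) False measure_empty mult_zero_right order_refl)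
    qed
  next
    case (Suc n)
    consider "y i = r" | "y i \<notin> K" | "y i \<noteq> r" "y i \<in> K" by auto
    then show ?case
    proof cases
      case 1 with triv[of i y "Suc n"] show ?thesis by simp
    next
      case 2
      then have "?E (Suc n) i y = {}" by force
      then have "measure P (?E (Suc n) i y) = 0" by (simp only: measure_empty)
      then show ?thesis using hit_within_nonneg[OF p, where x="y i" and n="Suc n" and r=r]
        by (simp only: mult_nonneg_nonneg measure_nonneg)
    next
      case 3
      have Y: "y(Suc i := z) \<in> UNIV \<rightarrow> V" if "z \<in> K" for z
        using Suc.prems that K by (auto simp: Pi_iff)
      have sub: "?E (Suc n) i y \<subseteq> (\<Union>z\<in>K. ?E n (Suc i) (y(Suc i := z)))"
      proof
        fix Y assume "Y \<in> ?E (Suc n) i y"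
        then obtain j where j: "Y \<in> space P" "\<forall>j\<le>i. Y j = y j" "j \<le> Suc n" "Y (i + j) = r"
          "\<forall>l\<le>j. Y (i + l) \<in> K" by auto
        with 3 have "j \<noteq> 0" by (metis add_0_right order_refl)
        then obtain j' where j': "j = Suc j'" by (cases j) auto
        have "\<forall>h\<le>Suc i. Y h = (y(Suc i := Y (Suc i))) h"
          using j(2) by (simp add: le_Suc_eq)
        moreover have "j' \<le> n" "Y (Suc i + j') = r" using j(3,4) j' by simp_all
        moreover have "Y (Suc i + l) \<in> K" if "l \<le> j'" for l
          using j(5)[rule_format, of "Suc l"] j' that by simp
        ultimately have "Y \<in> ?E n (Suc i) (y(Suc i := Y (Suc i)))"
          using j(1) by blast
        moreover have "Y (Suc i) \<in> K" using j(5)[rule_format, of 1] j' by simp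
        ultimately show "Y \<in> (\<Union>z\<in>K. ?E n (Suc i) (y(Suc i := z)))" by blast
      qed
      have "measure P (?E (Suc n) i y) \<le> measure P (\<Union>z\<in>K. ?E n (Suc i) (y(Suc i := z)))"
        by (rule finite_measure_mono[OF sub]) (use K in auto)
      also have "\<dots> \<le> (\<Sum>z\<in>K. measure P (?E n (Suc i) (y(Suc i := z))))"
        by (rule finite_measure_subadditive_finite) (use K in auto)
      also have "\<dots> \<le> (\<Sum>z\<in>K. measure P (?C i y) * p (y i) z * hit_within K p r n z)"
      proof (rule sum_mono)
        fix z assume z: "z \<in> K"
        have "measure P (?E n (Suc i) (y(Suc i := z))) \<le>
            measure P (?C (Suc i) (y(Suc i := z))) * hit_within K p r n ((y(Suc i := z)) (Suc i))"
          by (rule Suc.IH[OF Y[OF z]])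
        also have "measure P (?C (Suc i) (y(Suc i := z))) =
            measure P (?C i (y(Suc i := z))) * p ((y(Suc i := z)) i) ((y(Suc i := z)) (Suc i))"
          using P Y[OF z] unfolding markov_chain_law_def by blast
        also have "?C i (y(Suc i := z)) = ?C i y" by auto
        finally show "measure P (?E n (Suc i) (y(Suc i := z))) \<le>
            measure P (?C i y) * p (y i) z * hit_within K p r n z" by simp
      qed
      also have "\<dots> = measure P (?C i y) * hit_within K p r (Suc n) (y i)"
        using 3 by (simp add: sum_distrib_left mult.assoc)
      finally show ?thesis .
    qed
  }
qed

text \<open>
  The first step is taken separately so that a visit to \<open>r\<close> at time \<open>0\<close> does not count. For \<open>x = r\<close> this bounds the
  probability of a return, which is what the energy of the hitting probabilities depends on.
\<close>

lemma markov_chain_return_le: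
  assumes P: "markov_chain_law V p x P" and K: "finite K" "K \<subseteq> V" "r \<in> K" "x \<in> V"
    and p: "\<And>x y. x \<in> K \<Longrightarrow> y \<in> K \<Longrightarrow> 0 \<le> p x y"
  shows "\<P>(Y in P. Y 0 = x \<and> (\<exists>j\<le>n. Y (Suc j) = r \<and> (\<forall>l\<le>j. Y (Suc l) \<in> K)))
       \<le> (\<Sum>z\<in>K. p x z * hit_within K p r n z)" (is "measure P ?A \<le> _")
proof -
  interpret prob_space P using P by (simp add: markov_chain_law_def)
  note [measurable] = markov_chain_law_pred[OF P] markov_chain_law_pred_eq[OF P]
  define y where "y z = (\<lambda>i::nat. if i = 0 then x else z)" for z
  define E where "E z = {Y\<in>space P. (\<forall>j\<le>1. Y j = y z j) \<and> (\<exists>j\<le>n. Y (1 + j) = r \<and> (\<forall>l\<le>j. Y (1 + l) \<in> K))}" for z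
  have E[measurable]: "E z \<in> sets P" for z unfolding E_def by measurable
  have A[measurable]: "?A \<in> sets P" by measurable
  have sub: "?A \<subseteq> (\<Union>z\<in>K. E z)"
  proof
    fix Y assume "Y \<in> ?A"
    then obtain j where j: "Y \<in> space P" "Y 0 = x" "j \<le> n" "Y (Suc j) = r" "\<forall>l\<le>j. Y (Suc l) \<in> K"
      by auto
    then have "Y \<in> E (Y 1)" by (auto simp: E_def y_def le_Suc_eq)
    moreover have "Y 1 \<in> K" using j(5) by auto
    ultimately show "Y \<in> (\<Union>z\<in>K. E z)" by blast
  qed
  have "measure P ?A \<le> measure P (\<Union>z\<in>K. E z)"
    by (rule finite_measure_mono[OF sub]) (use K in auto)
  also have "\<dots> \<le> (\<Sum>z\<in>K. measure P (E z))"
    by (rule finite_measure_subadditive_finite) (use K in auto)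
  also have "\<dots> \<le> (\<Sum>z\<in>K. p x z * hit_within K p r n z)"
  proof (rule sum_mono)
    fix z assume z: "z \<in> K"
    have Y: "y z \<in> UNIV \<rightarrow> V" using K z by (auto simp: y_def)
    have "measure P (E z) \<le> \<P>(Y in P. \<forall>j\<le>1. Y j = y z j) * hit_within K p r n (y z 1)"
      unfolding E_def by (rule markov_chain_hit_le[OF P K(1-3) p Y])
    also have "\<P>(Y in P. \<forall>j\<le>1. Y j = y z j) = \<P>(Y in P. \<forall>j\<le>Suc 0. Y j = y z j)" by simp
    also have "\<dots> = \<P>(Y in P. \<forall>j\<le>0. Y j = y z j) * p (y z 0) (y z (Suc 0))"
      using P Y unfolding markov_chain_law_def by blast
    also have "\<P>(Y in P. \<forall>j\<le>0. Y j = y z j) = \<P>(Y in P. Y 0 = x)" by (simp add: y_def)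
    also have "\<dots> = 1" using P by (simp add: markov_chain_law_def)
    finally show "measure P (E z) \<le> p x z * hit_within K p r n z" by (simp add: y_def)
  qed
  finally show ?thesis .
qed

text \<open>
  A trajectory that visits \<open>r\<close> has done so by a finite time and within a finite set. Exhausting
  the countable \<open>V\<close> by finite sets, continuity of the measure from below makes the
  restricted hitting probabilities as close to \<open>1\<close> as desired.
\<close>

lemma almost_sure_hit_in_finite_region:
  assumes V: "countable V" and r: "r \<in> V" and F: "finite F" "F \<subseteq> V"
    and P: "\<And>x. x \<in> F \<Longrightarrow> \<exists>P. markov_chain_law V p x P \<and> \<P>(Y in P. \<exists>k>0. Y k = r) = 1"
    and p: "\<And>x y. x \<in> V \<Longrightarrow> y \<in> V \<Longrightarrow> 0 \<le> p x y" and e: "e > 0"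
  shows "\<exists>K n. finite K \<and> K \<subseteq> V \<and> F \<subseteq> K \<and> r \<in> K \<and>
           (\<forall>x\<in>F. 1 - e < (\<Sum>z\<in>K. p x z * hit_within K p r n z))"
proof -
  define K where "K n = insert r F \<union> from_nat_into V ` {..n}" for n
  have K: "finite (K n)" "K n \<subseteq> V" "F \<subseteq> K n" "r \<in> K n" for n
    using F r from_nat_into[of V] by (auto simp: K_def)
  have Kmono: "K m \<subseteq> K n" if "m \<le> n" for m n using that by (auto simp: K_def)
  have Kex: "\<exists>n. v \<in> K n" if "v \<in> V" for v
    using from_nat_into_to_nat_on[OF V that] unfolding K_def by (metis UnI2 atMost_iff image_eqI order_refl)
  have "\<forall>\<^sub>F n in sequentially. 1 - e < (\<Sum>z\<in>K n. p x z * hit_within (K n) p r n z)" if x: "x \<in> F" for x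
  proof -
    obtain P where P: "markov_chain_law V p x P" and hit: "\<P>(Y in P. \<exists>k>0. Y k = r) = 1"
      using assms(5)[OF x] by blast
    interpret prob_space P using P by (simp add: markov_chain_law_def)
    note [measurable] = markov_chain_law_pred[OF P] markov_chain_law_pred_eq[OF P]
    have sp: "Y l \<in> V" if "Y \<in> space P" for Y l
    proof -
      have "space P = space (Pi\<^sub>M UNIV (\<lambda>_::nat. count_space V))"
        using P by (intro sets_eq_imp_space_eq) (simp add: markov_chain_law_def)
      then show ?thesis using that by (auto simp: space_PiM)
    qed
    define A where "A n = {Y\<in>space P. Y 0 = x \<and> (\<exists>j\<le>n. Y (Suc j) = r \<and> (\<forall>l\<le>j. Y (Suc l) \<in> K n))}" for n
    have [measurable]: "A n \<in> sets P" for n unfolding A_def by measurable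
    have "incseq A"
    proof (rule monoI)
      fix m n :: nat assume "m \<le> n"
      then show "A m \<subseteq> A n" using Kmono[of m n] unfolding A_def by (auto intro: order_trans)
    qed
    have UA: "(\<Union>n. A n) = {Y\<in>space P. Y 0 = x \<and> (\<exists>k>0. Y k = r)}" (is "_ = ?B")
    proof (intro equalityI subsetI)
      fix Y assume "Y \<in> ?B"
      then obtain k where Y: "Y \<in> space P" "Y 0 = x" "k > 0" "Y k = r" by auto
      then obtain j where j: "Y (Suc j) = r" by (cases k) auto
      have "\<forall>l. \<exists>n. Y (Suc l) \<in> K n" using Kex[OF sp[OF Y(1)]] by blast
      then obtain N where N: "\<And>l. Y (Suc l) \<in> K (N l)" by metis
      define n where "n = Max (insert j (N ` {..j}))"
      have "j \<le> n" "\<And>l. l \<le> j \<Longrightarrow> N l \<le> n" by (auto simp: n_def le_max_iff_disj)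
      then have "Y \<in> A n" using Y j N Kmono unfolding A_def by blast
      then show "Y \<in> (\<Union>n. A n)" by blast
    qed (auto simp: A_def)
    have "AE Y in P. Y 0 = x"
    proof -
      have "\<P>(Y in P. Y 0 = x) = 1" using P by (simp add: markov_chain_law_def)
      then show ?thesis by (subst (asm) prob_Collect_eq_1) measurable
    qed
    moreover have "AE Y in P. \<exists>k>0. Y k = r"
      using hit by (subst (asm) prob_Collect_eq_1) measurable
    ultimately have "AE Y in P. Y 0 = x \<and> (\<exists>k>0. Y k = r)" by eventually_elim simp
    then have "measure P ?B = 1" by (subst prob_Collect_eq_1) measurable
    moreover have "(\<lambda>n. measure P (A n)) \<longlonglongrightarrow> measure P (\<Union>n. A n)"
      by (rule finite_Lim_measure_incseq) (use \<open>incseq A\<close> in auto)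
    ultimately have "(\<lambda>n. measure P (A n)) \<longlonglongrightarrow> 1" by (simp add: UA)
    then have ev: "\<forall>\<^sub>F n in sequentially. 1 - e < measure P (A n)"
      using e by (intro order_tendstoD(1)) auto
    have le: "measure P (A n) \<le> (\<Sum>z\<in>K n. p x z * hit_within (K n) p r n z)" for n
      unfolding A_def
      by (rule markov_chain_return_le[OF P]) (use K[of n] x F p in \<open>auto simp: subset_iff\<close>)
    show ?thesis by (rule eventually_mono[OF ev]) (rule less_le_trans[OF _ le])
  qed
  then have "\<forall>\<^sub>F n in sequentially. \<forall>x\<in>F. 1 - e < (\<Sum>z\<in>K n. p x z * hit_within (K n) p r n z)"
    using F(1) by (simp add: eventually_ball_finite)
  then obtain n where "\<forall>x\<in>F. 1 - e < (\<Sum>z\<in>K n. p x z * hit_within (K n) p r n z)"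
    using eventually_happens'[OF sequentially_bot] by blast
  with K[of n] show ?thesis by (intro exI[of _ "K n"] exI[of _ n]) simp
qed

section \<open>Energies and flows on graphs with finite vertex degrees\<close>

lemma has_sum_finite_Times:
  fixes f :: "'a \<Rightarrow> 'b \<Rightarrow> 'c::topological_comm_monoid_add"
  assumes K: "finite K" "K \<subseteq> A" and rows: "\<And>x. x \<in> K \<Longrightarrow> (f x has_sum g x) B"
    and zero: "\<And>x y. x \<notin> K \<Longrightarrow> f x y = 0"
  shows "((\<lambda>(x, y). f x y) has_sum sum g K) (A \<times> B)"
proof -
  have "((\<lambda>(x, y). f x y) has_sum sum g K) (\<Union>x\<in>K. Pair x ` B)"
  proof (rule sum_has_sum[OF K(1)])
    fix x assume "x \<in> K"
    then show "((\<lambda>(x, y). f x y) has_sum g x) (Pair x ` B)"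
      using rows by (subst has_sum_reindex) (auto simp: inj_on_def o_def)
  qed auto
  moreover have "((\<lambda>(x, y). f x y) has_sum sum g K) (\<Union>x\<in>K. Pair x ` B) =
      ((\<lambda>(x, y). f x y) has_sum sum g K) (A \<times> B)"
  proof (rule has_sum_cong_neutral)
    fix z assume "z \<in> A \<times> B - (\<Union>x\<in>K. Pair x ` B)"
    then have "fst z \<notin> K" by (auto simp: image_iff)
    then show "(case z of (x, y) \<Rightarrow> f x y) = 0" using zero by (cases z) simp
  qed (use K in auto)
  ultimately show ?thesis by simp
qed

text \<open>
  The elementary inequality \<open>2st \<le> s\<^sup>2/e + e t\<^sup>2\<close>. It gives the summability of products that
  Cauchy--Schwarz would give, and with a small \<open>e\<close> it bounds a pairing when the energy of one of the factors is small.
\<close>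

lemma weighted_le_sum_squares:
  fixes b s t :: real
  assumes "0 \<le> b" "0 < e"
  shows "b * (s * t) \<le> (b * s\<^sup>2 / e + e * (b * t\<^sup>2)) / 2"
proof -
  have "0 \<le> (s - e * t)\<^sup>2" by simp
  then have "2 * e * (s * t) \<le> s\<^sup>2 + e\<^sup>2 * t\<^sup>2"
    by (simp add: power2_eq_square algebra_simps)
  then have "s * t \<le> (s\<^sup>2 / e + e * t\<^sup>2) / 2"
    using assms(2) by (simp add: field_simps power2_eq_square)
  then have "b * (s * t) \<le> b * ((s\<^sup>2 / e + e * t\<^sup>2) / 2)"
    by (rule mult_left_mono[OF _ assms(1)])
  then show ?thesis by (simp add: algebra_simps)
qed

locale finite_degree_graph =
  fixes V :: "'v set" and b :: "'v \<Rightarrow> 'v \<Rightarrow> real"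
  assumes b_nonneg: "x \<in> V \<Longrightarrow> y \<in> V \<Longrightarrow> 0 \<le> b x y"
    and b_sym: "x \<in> V \<Longrightarrow> y \<in> V \<Longrightarrow> b x y = b y x"
    and b_summable: "x \<in> V \<Longrightarrow> b x summable_on V"
begin

abbreviation vertex_degree :: "'v \<Rightarrow> real" where
  "vertex_degree x \<equiv> \<Sum>\<^sub>\<infinity>z\<in>V. b x z"

abbreviation step_prob :: "'v \<Rightarrow> 'v \<Rightarrow> real" where
  "step_prob \<equiv> transition_prob V b"

lemma degree_nonneg: "x \<in> V \<Longrightarrow> 0 \<le> vertex_degree x"
  by (intro infsum_nonneg b_nonneg)

lemma trans_nonneg: "x \<in> V \<Longrightarrow> y \<in> V \<Longrightarrow> 0 \<le> step_prob x y"
  by (simp add: transition_prob_def b_nonneg degree_nonneg)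

lemma degree_mult_trans:
  assumes "x \<in> V" "y \<in> V"
  shows "vertex_degree x * step_prob x y = b x y"
proof (cases "vertex_degree x = 0")
  case True
  then have "b x y = 0"
    using nonneg_infsum_le_0D[of "b x" V y] assms b_summable b_nonneg by simp
  with True show ?thesis by simp
qed (simp add: transition_prob_def)

lemma sum_trans_le_1:
  assumes "x \<in> V" "finite K" "K \<subseteq> V"
  shows "(\<Sum>y\<in>K. step_prob x y) \<le> 1"
proof -
  have "(\<Sum>y\<in>K. b x y) \<le> vertex_degree x"
    using assms b_nonneg by (intro finite_sum_le_infsum b_summable) auto
  then show ?thesis
    using degree_nonneg[OF assms(1)]
    by (simp add: transition_prob_def divide_le_eq flip: sum_divide_distrib)
qed

text \<open>
  Green's formula: by symmetry of \<open>b\<close>, each of the two halves of \<open>(\<phi> x - \<phi> y)\<^sup>2 = \<phi> x (\<phi> x - \<phi> y) + \<phi> y (\<phi> y - \<phi> x)\<close>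
  contributes the pairing of \<open>\<phi>\<close> with its graph Laplacian.
\<close>

lemma energy_has_sum:
  assumes K: "finite K" "K \<subseteq> V" and \<phi>: "\<And>x. x \<notin> K \<Longrightarrow> \<phi> x = 0"
  shows "((\<lambda>(x, y). b x y * (\<phi> x - \<phi> y)\<^sup>2) has_sum
           2 * (\<Sum>x\<in>K. \<phi> x * (vertex_degree x * \<phi> x - (\<Sum>y\<in>K. b x y * \<phi> y)))) (V \<times> V)"
proof -
  define g where "g x y = b x y * (\<phi> x * (\<phi> x - \<phi> y))" for x y
  define T where "T = (\<Sum>x\<in>K. \<phi> x * (vertex_degree x * \<phi> x - (\<Sum>y\<in>K. b x y * \<phi> y)))"
  have row: "(g x has_sum \<phi> x * (vertex_degree x * \<phi> x - (\<Sum>y\<in>K. b x y * \<phi> y))) V" if "x \<in> K" for x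
  proof -
    have "((\<lambda>y. b x y * \<phi> y) has_sum (\<Sum>y\<in>K. b x y * \<phi> y)) V"
      by (rule has_sum_finite_neutralI) (use K \<phi> in auto)
    moreover have "(b x has_sum vertex_degree x) V" using that K b_summable by auto
    then have "((\<lambda>y. b x y * \<phi> x) has_sum vertex_degree x * \<phi> x) V" by (rule has_sum_cmult_left)
    ultimately have "((\<lambda>y. b x y * \<phi> x + - (b x y * \<phi> y)) has_sum (vertex_degree x * \<phi> x + - (\<Sum>y\<in>K. b x y * \<phi> y))) V"
      by (intro has_sum_add has_sum_uminusI)
    then have "((\<lambda>y. \<phi> x * (b x y * \<phi> x + - (b x y * \<phi> y))) has_sum
        \<phi> x * (vertex_degree x * \<phi> x + - (\<Sum>y\<in>K. b x y * \<phi> y))) V"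
      by (rule has_sum_cmult_right)
    then show ?thesis by (simp add: g_def[abs_def] algebra_simps)
  qed
  have 1: "((\<lambda>(x, y). g x y) has_sum T) (V \<times> V)"
    unfolding T_def by (rule has_sum_finite_Times[OF K row]) (simp_all add: g_def \<phi>)
  then have 2: "((\<lambda>(x, y). g y x) has_sum T) (V \<times> V)"
    by (subst (asm) has_sum_swap) simp
  have "((\<lambda>z. (case z of (x, y) \<Rightarrow> g x y) + (case z of (x, y) \<Rightarrow> g y x)) has_sum T + T) (V \<times> V)"
    by (rule has_sum_add[OF 1 2])
  moreover have "((\<lambda>z. (case z of (x, y) \<Rightarrow> g x y) + (case z of (x, y) \<Rightarrow> g y x)) has_sum T + T) (V \<times> V)
     = ((\<lambda>(x, y). b x y * (\<phi> x - \<phi> y)\<^sup>2) has_sum T + T) (V \<times> V)"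
    by (rule has_sum_cong)
       (auto simp: g_def power2_eq_square algebra_simps dest: b_sym)
  ultimately show ?thesis unfolding T_def by simp
qed

text \<open>
  Off the root the Laplacian of the hitting probabilities is nonpositive by \<open>hit_within_mono\<close>, so only the root
  contributes to the energy, and there the Laplacian measures the probability of not returning.
\<close>

lemma hit_within_energy_le:
  fixes K r n
  defines "\<phi> \<equiv> hit_within K step_prob r (Suc n)"
  assumes K: "finite K" "K \<subseteq> V" "r \<in> K"
  shows "(\<Sum>x\<in>K. \<phi> x * (vertex_degree x * \<phi> x - (\<Sum>y\<in>K. b x y * \<phi> y)))
       \<le> vertex_degree r * (1 - (\<Sum>y\<in>K. step_prob r y * hit_within K step_prob r n y))"
proof -
  have tr: "\<And>x y. x \<in> K \<Longrightarrow> y \<in> K \<Longrightarrow> 0 \<le> step_prob x y" using K trans_nonneg by blast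
  have mono: "hit_within K step_prob r n y \<le> \<phi> y" for y
    unfolding \<phi>_def by (rule hit_within_mono[OF tr])
  have nonneg: "0 \<le> \<phi> x" for x unfolding \<phi>_def by (rule hit_within_nonneg[OF tr])
  have eq: "vertex_degree x * \<phi> x - (\<Sum>y\<in>K. b x y * \<phi> y) = vertex_degree x * (\<phi> x - (\<Sum>y\<in>K. step_prob x y * \<phi> y))"
    if "x \<in> K" for x
  proof -
    have "(\<Sum>y\<in>K. b x y * \<phi> y) = (\<Sum>y\<in>K. vertex_degree x * (step_prob x y * \<phi> y))"
      using that K degree_mult_trans by (intro sum.cong) (auto simp: subset_iff simp flip: mult.assoc)
    then show ?thesis by (simp add: sum_distrib_left right_diff_distrib)
  qed
  have le: "(\<Sum>y\<in>K. step_prob x y * hit_within K step_prob r n y) \<le> (\<Sum>y\<in>K. step_prob x y * \<phi> y)" if "x \<in> K" for x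
    using that tr mono by (intro sum_mono mult_left_mono) auto
  have "(\<Sum>x\<in>K. \<phi> x * (vertex_degree x * \<phi> x - (\<Sum>y\<in>K. b x y * \<phi> y)))
      \<le> (\<Sum>x\<in>K. if x = r then vertex_degree r * (1 - (\<Sum>y\<in>K. step_prob r y * hit_within K step_prob r n y)) else 0)"
  proof (rule sum_mono)
    fix x assume x: "x \<in> K"
    have d: "0 \<le> vertex_degree x" using x K degree_nonneg by auto
    show "\<phi> x * (vertex_degree x * \<phi> x - (\<Sum>y\<in>K. b x y * \<phi> y)) \<le>
        (if x = r then vertex_degree r * (1 - (\<Sum>y\<in>K. step_prob r y * hit_within K step_prob r n y)) else 0)"
    proof (cases "x = r")
      case True
      have "\<phi> r = 1" by (simp add: \<phi>_def)
      have "vertex_degree r * (1 - (\<Sum>y\<in>K. step_prob r y * \<phi> y)) \<le>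
          vertex_degree r * (1 - (\<Sum>y\<in>K. step_prob r y * hit_within K step_prob r n y))"
        using le[OF x] d True by (intro mult_left_mono) auto
      then show ?thesis using eq[OF x] True \<open>\<phi> r = 1\<close> by simp
    next
      case False
      then have "\<phi> x = (\<Sum>y\<in>K. step_prob x y * hit_within K step_prob r n y)" using x by (simp add: \<phi>_def)
      with le[OF x] have "\<phi> x - (\<Sum>y\<in>K. step_prob x y * \<phi> y) \<le> 0" by simp
      then have "vertex_degree x * (\<phi> x - (\<Sum>y\<in>K. step_prob x y * \<phi> y)) \<le> 0"
        by (rule mult_nonneg_nonpos[OF d])
      then have "\<phi> x * (vertex_degree x * (\<phi> x - (\<Sum>y\<in>K. step_prob x y * \<phi> y))) \<le> 0"
        by (rule mult_nonneg_nonpos[OF nonneg])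
      then show ?thesis using False by (simp add: eq[OF x])
    qed
  qed
  also have "\<dots> = vertex_degree r * (1 - (\<Sum>y\<in>K. step_prob r y * hit_within K step_prob r n y))"
    using K by (simp add: sum.delta)
  finally show ?thesis .
qed

text \<open>
  The analytic form of recurrence: the constant \<open>1\<close> is a limit of finitely supported functions whose energies tend to \<open>0\<close>.
\<close>

lemma recurrent_cutoff:
  assumes rec: "recurrent V b" and V: "countable V" and F: "finite F" "F \<subseteq> V" and e: "0 < e"
  obtains \<phi> K E where "finite K" "K \<subseteq> V" "\<And>x. x \<notin> K \<Longrightarrow> \<phi> x = 0" "\<And>x. 0 \<le> \<phi> x" "\<And>x. \<phi> x \<le> 1"
    "\<And>x. x \<in> F \<Longrightarrow> 1 - e \<le> \<phi> x"
    "((\<lambda>(x, y). b x y * (\<phi> x - \<phi> y)\<^sup>2) has_sum E) (V \<times> V)" "E \<le> e"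
proof (cases "\<exists>v. V = {v}")
  case True
  then obtain v where v: "V = {v}" by blast
  have "((\<lambda>(x, y). b x y * (indicator {v} x - indicator {v} y)\<^sup>2) has_sum 0) (V \<times> V)"
    by (rule has_sum_0) (use v in auto)
  then show ?thesis using v e F
    by (intro that[of "{v}" "indicator {v}" 0]) (auto simp: indicator_def)
next
  case not_single: False
  show ?thesis
  proof (cases "V = {}")
    case True
    then show ?thesis using e F by (intro that[of "{}" "\<lambda>_. 0" 0]) auto
  next
    case False
    then obtain r where r: "r \<in> V" by blast
    have P: "\<exists>P. markov_chain_law V step_prob x P \<and> \<P>(Y in P. \<exists>k>0. Y k = y) = 1"
      if "x \<in> V" "y \<in> V" for x y
      using rec not_single that by (auto simp: recurrent_def)
    \<comment> \<open>With this choice twice the degree of the root times \<open>e'\<close> is at most \<open>e\<close>.\<close>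
    define e' where "e' = min e (e / (2 * (vertex_degree r + 1)))"
    have d: "0 \<le> vertex_degree r" by (rule degree_nonneg[OF r])
    have e': "0 < e'" "e' \<le> e" "e' \<le> e / (2 * (vertex_degree r + 1))" using e d by (auto simp: e'_def)
    have "\<exists>K n. finite K \<and> K \<subseteq> V \<and> insert r F \<subseteq> K \<and> r \<in> K \<and>
           (\<forall>x\<in>insert r F. 1 - e' < (\<Sum>z\<in>K. step_prob x z * hit_within K step_prob r n z))"
      by (rule almost_sure_hit_in_finite_region)
         (use V r F e' trans_nonneg P in auto)
    then obtain K n where K: "finite K" "K \<subseteq> V" "insert r F \<subseteq> K" "r \<in> K"
      and hit: "\<And>x. x \<in> insert r F \<Longrightarrow> 1 - e' < (\<Sum>z\<in>K. step_prob x z * hit_within K step_prob r n z)"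
      by blast
    define \<phi> where "\<phi> = hit_within K step_prob r (Suc n)"
    define E where "E = 2 * (\<Sum>x\<in>K. \<phi> x * (vertex_degree x * \<phi> x - (\<Sum>y\<in>K. b x y * \<phi> y)))"
    have tr: "\<And>x y. x \<in> K \<Longrightarrow> y \<in> K \<Longrightarrow> 0 \<le> step_prob x y" using K trans_nonneg by blast
    have out: "\<phi> x = 0" if "x \<notin> K" for x
      using that K hit_within_outside[of r K x step_prob "Suc n"] by (simp add: \<phi>_def)
    have bounds: "0 \<le> \<phi> x" "\<phi> x \<le> 1" for x
      unfolding \<phi>_def using K
      by (auto intro!: hit_within_nonneg[OF tr] hit_within_le_1[OF tr] sum_trans_le_1 simp del: hit_within.simps)
    have low: "1 - e \<le> \<phi> x" if "x \<in> F" for x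
    proof (cases "x = r")
      case False
      then have "\<phi> x = (\<Sum>z\<in>K. step_prob x z * hit_within K step_prob r n z)"
        using that K by (auto simp: \<phi>_def)
      with hit[of x] that e' show ?thesis by simp
    qed (use e in \<open>simp add: \<phi>_def\<close>)
    have "E \<le> 2 * (vertex_degree r * (1 - (\<Sum>y\<in>K. step_prob r y * hit_within K step_prob r n y)))"
      unfolding E_def \<phi>_def by (rule mult_left_mono[OF hit_within_energy_le]) (use K in auto)
    also have "\<dots> \<le> 2 * (vertex_degree r * e')"
      using hit[of r] d by (intro mult_left_mono) auto
    also have "\<dots> \<le> 2 * (vertex_degree r * (e / (2 * (vertex_degree r + 1))))"
      using e' d by (intro mult_left_mono) auto
    also have "\<dots> \<le> e" using d e by (simp add: field_simps)
    finally have "E \<le> e" .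
    moreover have "((\<lambda>(x, y). b x y * (\<phi> x - \<phi> y)\<^sup>2) has_sum E) (V \<times> V)"
      unfolding E_def by (rule energy_has_sum[OF K(1,2) out])
    ultimately show ?thesis using that[of K \<phi> E] K out bounds low by simp
  qed
qed

lemma flow_row_summable:
  fixes F :: "'v \<Rightarrow> 'v \<Rightarrow> complex" and w :: "'v \<Rightarrow> 'v \<Rightarrow> real"
  assumes bound: "\<And>x y. x \<in> V \<Longrightarrow> y \<in> V \<Longrightarrow> cmod (F x y) \<le> b x y * w x y"
    and energy: "(\<lambda>(x, y). b x y * (w x y)\<^sup>2) summable_on V \<times> V" and x: "x \<in> V"
  shows "F x summable_on V"
proof -
  have "(\<lambda>y. b x y * (w x y)\<^sup>2) summable_on V" by (rule summable_on_SigmaD1[OF energy x])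
  then have "(\<lambda>y. (b x y + b x y * (w x y)\<^sup>2) * (1/2)) summable_on V"
    by (intro summable_on_cmult_left summable_on_add b_summable x)
  moreover have "cmod (F x y) \<le> (b x y + b x y * (w x y)\<^sup>2) * (1/2)" if "y \<in> V" for y
    using bound[OF x that] weighted_le_sum_squares[of "b x y" 1 1 "w x y"] b_nonneg[OF x that] by simp
  ultimately show ?thesis
    by (rule abs_summable_summable[OF Infinite_Sum.abs_summable_on_comparison_test'])
qed

text \<open>
  If \<open>\<phi>\<close> is finitely supported, then \<open>\<Sum>\<^sub>x \<phi>(x) div F(x) = 1/2 \<Sum>\<^sub>x\<^sub>,\<^sub>y (\<phi>(x) - \<phi>(y)) F(x, y)\<close> by antisymmetry, and the right
  side is bounded by the energies of \<open>\<phi>\<close> and \<open>F\<close>. Along the functions of \<open>recurrent_cutoff\<close> the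
  right side tends to \<open>0\<close> and the left side to the total divergence. The bound on \<open>F\<close> by
  \<open>b w\<close> expresses finite energy without dividing by \<open>b\<close>.
\<close>

theorem recurrent_flow_total_divergence:
  fixes F :: "'v \<Rightarrow> 'v \<Rightarrow> complex" and w :: "'v \<Rightarrow> 'v \<Rightarrow> real"
  assumes rec: "recurrent V b" and V: "countable V"
    and antisym: "\<And>x y. x \<in> V \<Longrightarrow> y \<in> V \<Longrightarrow> F x y = - F y x"
    and bound: "\<And>x y. x \<in> V \<Longrightarrow> y \<in> V \<Longrightarrow> cmod (F x y) \<le> b x y * w x y"
    and energy: "(\<lambda>(x, y). b x y * (w x y)\<^sup>2) summable_on V \<times> V"
    and div: "(\<lambda>x. \<Sum>\<^sub>\<infinity>y\<in>V. F x y) summable_on V"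
  shows "(\<Sum>\<^sub>\<infinity>x\<in>V. \<Sum>\<^sub>\<infinity>y\<in>V. F x y) = 0"
proof -
  define D where "D x = (\<Sum>\<^sub>\<infinity>y\<in>V. F x y)" for x
  define C where "C = (\<Sum>\<^sub>\<infinity>(x, y)\<in>V \<times> V. b x y * (w x y)\<^sup>2)"
  define M where "M = (\<Sum>\<^sub>\<infinity>x\<in>V. cmod (D x))"
  have D: "D summable_on V" using div by (simp add: D_def[abs_def])
  then have absD: "(\<lambda>x. cmod (D x)) summable_on V" by (simp add: summable_on_iff_abs_summable_on_complex)
  have row: "(F x has_sum D x) V" if "x \<in> V" for x
    using flow_row_summable[OF bound energy that] by (simp add: D_def)
  have main: "cmod (infsum D V) \<le> e * (M + 1 + (1 + C) / 4)" if e: "0 < e" "e < 1" for e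
  proof -
    obtain G where G: "finite G" "G \<subseteq> V" and Gs: "dist (\<Sum>x\<in>G. cmod (D x)) M \<le> e"
      unfolding M_def using infsum_finite_approximation[OF absD e(1)] by blast
    obtain \<phi> K E where K: "finite K" "K \<subseteq> V" and out: "\<And>x. x \<notin> K \<Longrightarrow> \<phi> x = 0"
      and b01: "\<And>x. 0 \<le> \<phi> x" "\<And>x. \<phi> x \<le> 1" and low: "\<And>x. x \<in> G \<Longrightarrow> 1 - e\<^sup>2 \<le> \<phi> x"
      and E: "((\<lambda>(x, y). b x y * (\<phi> x - \<phi> y)\<^sup>2) has_sum E) (V \<times> V)" "E \<le> e\<^sup>2"
      by (rule recurrent_cutoff[OF rec V G zero_less_power[OF e(1), of 2]]) blast
    \<comment> \<open>\<open>T\<close> pairs the cutoff with the divergence; it is computed once as a double sum and once with the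
      variables exchanged.\<close>
    define c where "c x = complex_of_real (\<phi> x)" for x
    have cout: "\<And>x. x \<notin> K \<Longrightarrow> c x = 0" by (simp add: c_def out)
    define T where "T = (\<Sum>x\<in>K. c x * D x)"
    have T: "((\<lambda>x. c x * D x) has_sum T) V"
      unfolding T_def by (rule has_sum_finite_neutralI) (use K cout in auto)
    have 1: "((\<lambda>(x, y). c x * F x y) has_sum T) (V \<times> V)"
      unfolding T_def
      by (rule has_sum_finite_Times[OF K], rule has_sum_cmult_right, rule row) (use K in \<open>auto simp: cout\<close>)
    then have 2: "((\<lambda>(x, y). c y * F y x) has_sum T) (V \<times> V)"
      by (subst (asm) has_sum_swap) simp
    have "((\<lambda>z. (case z of (x, y) \<Rightarrow> c x * F x y) + (case z of (x, y) \<Rightarrow> c y * F y x)) has_sum T + T) (V \<times> V)"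
      by (rule has_sum_add[OF 1 2])
    moreover have "((\<lambda>z. (case z of (x, y) \<Rightarrow> c x * F x y) + (case z of (x, y) \<Rightarrow> c y * F y x)) has_sum T + T) (V \<times> V)
        = ((\<lambda>(x, y). (c x - c y) * F x y) has_sum T + T) (V \<times> V)"
      by (rule has_sum_cong) (auto simp: left_diff_distrib dest: antisym)
    ultimately have diff: "((\<lambda>(x, y). (c x - c y) * F x y) has_sum T + T) (V \<times> V)" by simp
    have C: "((\<lambda>(x, y). b x y * (w x y)\<^sup>2) has_sum C) (V \<times> V)"
      using energy by (simp add: C_def)
    have "((\<lambda>z. 1 / (2 * e) * (case z of (x, y) \<Rightarrow> b x y * (\<phi> x - \<phi> y)\<^sup>2) +
                e / 2 * (case z of (x, y) \<Rightarrow> b x y * (w x y)\<^sup>2)) has_sum 1 / (2 * e) * E + e / 2 * C) (V \<times> V)"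
      by (intro has_sum_add has_sum_cmult_right E C)
    then have "cmod (T + T) \<le> 1 / (2 * e) * E + e / 2 * C"
    proof (rule norm_infsum_le[OF diff])
      fix z assume "z \<in> V \<times> V"
      then obtain x y where z: "z = (x, y)" "x \<in> V" "y \<in> V" by auto
      have "cmod ((c x - c y) * F x y) = \<bar>\<phi> x - \<phi> y\<bar> * cmod (F x y)"
        by (simp add: c_def norm_mult flip: of_real_diff)
      also have "\<dots> \<le> \<bar>\<phi> x - \<phi> y\<bar> * (b x y * w x y)"
        by (intro mult_left_mono bound z) auto
      also have "\<dots> \<le> (b x y * (\<phi> x - \<phi> y)\<^sup>2 / e + e * (b x y * (w x y)\<^sup>2)) / 2"
        using weighted_le_sum_squares[of "b x y" e "\<bar>\<phi> x - \<phi> y\<bar>" "w x y"] b_nonneg[OF z(2,3)] e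
        by (simp add: mult_ac)
      finally show "cmod (case z of (x, y) \<Rightarrow> (c x - c y) * F x y) \<le>
          1 / (2 * e) * (case z of (x, y) \<Rightarrow> b x y * (\<phi> x - \<phi> y)\<^sup>2) +
                e / 2 * (case z of (x, y) \<Rightarrow> b x y * (w x y)\<^sup>2)"
        by (simp add: z field_simps)
    qed
    also have "1 / (2 * e) * E \<le> 1 / (2 * e) * e\<^sup>2" using E e by (intro mult_left_mono) auto
    also have "1 / (2 * e) * e\<^sup>2 = e / 2" using e by (simp add: power2_eq_square)
    also have "cmod (T + T) = 2 * cmod T" by (simp flip: mult_2 add: norm_mult)
    finally have Tle: "cmod T \<le> e * ((1 + C) / 4)" by (simp add: field_simps)
    \<comment> \<open>The remaining part, paired with \<open>1 - \<phi>\<close>, is small on \<open>G\<close> since \<open>\<phi>\<close> is near \<open>1\<close> there, and small off \<open>G\<close>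
      since \<open>G\<close> carries almost all of the divergence.\<close>
    have absM: "((\<lambda>x. cmod (D x)) has_sum M) V" using absD by (simp add: M_def)
    have "((\<lambda>x. if x \<in> G then cmod (D x) else 0) has_sum (\<Sum>x\<in>G. cmod (D x))) V"
      by (rule has_sum_finite_neutralI) (use G in auto)
    then have dom: "((\<lambda>x. e * cmod (D x) + (cmod (D x) + - (if x \<in> G then cmod (D x) else 0))) has_sum
        e * M + (M + - (\<Sum>x\<in>G. cmod (D x)))) V"
      by (intro has_sum_add has_sum_cmult_right has_sum_uminusI absM)
    have rest: "((\<lambda>x. D x + - (c x * D x)) has_sum infsum D V + - T) V"
      by (intro has_sum_add has_sum_uminusI T has_sum_infsum D)
    have "cmod (infsum D V + - T) \<le> e * M + (M + - (\<Sum>x\<in>G. cmod (D x)))"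
    proof (rule norm_infsum_le[OF rest dom])
      fix x assume "x \<in> V"
      have "D x + - (c x * D x) = of_real (1 - \<phi> x) * D x" by (simp add: c_def algebra_simps)
      then have eq: "cmod (D x + - (c x * D x)) = (1 - \<phi> x) * cmod (D x)"
        using b01(2)[of x] by (simp only: norm_mult norm_of_real)
      have "e\<^sup>2 \<le> e" using e by (simp add: power2_eq_square)
      then have "1 - \<phi> x \<le> e" if "x \<in> G" using low[OF that] by simp
      then have "(1 - \<phi> x) * cmod (D x) \<le> e * cmod (D x)" if "x \<in> G"
        using that by (intro mult_right_mono) auto
      moreover have "(1 - \<phi> x) * cmod (D x) \<le> 1 * cmod (D x)" 
        using b01(1)[of x] by (intro mult_right_mono) auto
      moreover have "0 \<le> e * cmod (D x)" using e by simp
      ultimately show "cmod (D x + - (c x * D x)) \<le>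
          e * cmod (D x) + (cmod (D x) + - (if x \<in> G then cmod (D x) else 0))"
        unfolding eq by auto
    qed
    also have "\<dots> \<le> e * M + e" using Gs by (simp add: dist_real_def)
    finally have "cmod (infsum D V + - T) \<le> e * M + e" .
    moreover have "cmod (infsum D V) \<le> cmod (infsum D V + - T) + cmod T"
      using norm_triangle_ineq[of "infsum D V + - T" T] by simp
    moreover have "e * (M + 1 + (1 + C) / 4) = e * M + e + e * ((1 + C) / 4)"
      by (simp only: distrib_left mult_1_right)
    ultimately show ?thesis using Tle by linarith
  qed
  define B where "B = M + 1 + (1 + C) / 4"
  have "cmod (infsum D V) \<le> 0"
  proof (rule tendsto_lowerbound)
    show "((\<lambda>e. e * B) \<longlongrightarrow> 0) (at_right 0)" by (auto intro!: tendsto_eq_intros)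
    show "\<forall>\<^sub>F e in at_right 0. cmod (infsum D V) \<le> e * B"
      unfolding B_def using main eventually_at_right_less[of 0]
      by (intro eventually_at_rightI[of 0 1]) auto
  qed auto
  then show ?thesis by (simp add: D_def[abs_def])
qed

lemma finite_degree_subgraph:
  assumes "C \<subseteq> V"
  shows "finite_degree_graph C b"
proof
  fix x y assume "x \<in> C" "y \<in> C"
  with assms have "x \<in> V" "y \<in> V" by auto
  then show "0 \<le> b x y" "b x y = b y x" by (fact b_nonneg, fact b_sym)
next
  fix x assume "x \<in> C"
  then show "b x summable_on C"
    using summable_on_subset[OF b_summable assms] assms by blast
qed

abbreviation edges :: "('v \<times> 'v) set" where
  "edges \<equiv> {(v, v') \<in> V \<times> V. 0 < b v v'}"

lemma equiv_connected: "equiv V {(x, y) \<in> V \<times> V. (x, y) \<in> edges\<^sup>*}"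
proof (rule equivI)
  have "sym edges" by (auto simp: sym_def b_sym)
  then have "sym (edges\<^sup>*)" by (rule sym_rtrancl)
  then show "sym {(x, y) \<in> V \<times> V. (x, y) \<in> edges\<^sup>*}" unfolding sym_def by blast
  show "trans {(x, y) \<in> V \<times> V. (x, y) \<in> edges\<^sup>*}"
    unfolding trans_def by (auto intro: rtrancl_trans)
qed (auto simp: refl_on_def)

lemma component_subset: "C \<in> graph_components V b \<Longrightarrow> C \<subseteq> V"
  unfolding graph_components_def using equiv_connected by (rule in_quotient_imp_subset)

lemma Union_components: "\<Union> (graph_components V b) = V"
  unfolding graph_components_def by (rule Union_quotient[OF equiv_connected])

lemma component_disjoint:
  "C \<in> graph_components V b \<Longrightarrow> C' \<in> graph_components V b \<Longrightarrow> x \<in> C \<Longrightarrow> x \<in> C' \<Longrightarrow> C = C'"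
  using quotient_disj[OF equiv_connected] unfolding graph_components_def by blast

lemma component_no_edge_out:
  assumes C: "C \<in> graph_components V b" and x: "x \<in> C" and y: "y \<in> V - C"
  shows "b x y = 0"
proof (rule ccontr)
  assume "b x y \<noteq> 0"
  moreover have xV: "x \<in> V" using C x component_subset by blast
  ultimately have "(x, y) \<in> edges" using b_nonneg[of x y] y by auto
  then have "(x, y) \<in> {(x, y) \<in> V \<times> V. (x, y) \<in> edges\<^sup>*}" using xV y by blast
  then have "y \<in> C"
    using in_quotient_imp_closed[OF equiv_connected _ x] C unfolding graph_components_def by blast
  then show False using y by simp
qed

text \<open>
  A vertex has only countably many neighbours because its degree is finite, and finite paths
  reach countably many vertices in total.
\<close>

lemma countable_component:
  assumes "C \<in> graph_components V b"
  shows "countable C"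
proof -
  obtain x where C: "C = {(x, y) \<in> V \<times> V. (x, y) \<in> edges\<^sup>*} `` {x}" and "x \<in> V"
    using assms unfolding graph_components_def by (rule quotientE)
  have nb: "countable (edges `` {v})" for v
  proof (cases "v \<in> V")
    case True
    have "countable {y \<in> V. b v y \<noteq> 0}" by (rule summable_countable_real[OF b_summable[OF True]])
    then show ?thesis by (rule countable_subset[rotated]) auto
  qed auto
  have "countable ((edges ^^ n) `` {x})" for n
  proof (induction n)
    case (Suc n)
    have "(edges ^^ Suc n) `` {x} = (\<Union>v\<in>(edges ^^ n) `` {x}. edges `` {v})" by auto
    then show ?case using Suc nb by simp
  qed simp
  then have "countable (\<Union>n. (edges ^^ n) `` {x})" by simp
  moreover have "C \<subseteq> (\<Union>n. (edges ^^ n) `` {x})"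
    unfolding C by (auto simp: rtrancl_power)
  ultimately show ?thesis by (rule countable_subset[rotated])
qed

text \<open>
  No edge leaves a component, so the flow and its divergence restrict to each component, where
  the total divergence vanishes; summability of the divergence allows summing over the components.
\<close>

theorem flow_total_divergence:
  fixes F :: "'v \<Rightarrow> 'v \<Rightarrow> complex" and w :: "'v \<Rightarrow> 'v \<Rightarrow> real"
  assumes rec: "\<And>C. C \<in> graph_components V b \<Longrightarrow> recurrent C b"
    and antisym: "\<And>x y. x \<in> V \<Longrightarrow> y \<in> V \<Longrightarrow> F x y = - F y x"
    and bound: "\<And>x y. x \<in> V \<Longrightarrow> y \<in> V \<Longrightarrow> cmod (F x y) \<le> b x y * w x y"
    and energy: "(\<lambda>(x, y). b x y * (w x y)\<^sup>2) summable_on V \<times> V"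
    and div: "(\<lambda>x. \<Sum>\<^sub>\<infinity>y\<in>V. F x y) summable_on V"
  shows "(\<Sum>\<^sub>\<infinity>x\<in>V. \<Sum>\<^sub>\<infinity>y\<in>V. F x y) = 0"
proof -
  define D where "D = (\<lambda>x. \<Sum>\<^sub>\<infinity>y\<in>V. F x y)"
  let ?Q = "graph_components V b"
  have bij: "bij_betw snd (Sigma ?Q (\<lambda>C. C)) V"
  proof (rule bij_betwI')
    fix p q assume "p \<in> Sigma ?Q (\<lambda>C. C)" "q \<in> Sigma ?Q (\<lambda>C. C)"
    then show "(snd p = snd q) = (p = q)"
      using component_disjoint[of "fst p" "fst q" "snd p"] by (auto simp: prod_eq_iff)
  next
    fix p assume "p \<in> Sigma ?Q (\<lambda>C. C)"
    then show "snd p \<in> V" using component_subset[of "fst p"] by auto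
  next
    fix v assume "v \<in> V"
    then obtain C where "C \<in> ?Q" "v \<in> C" using Union_components by blast
    then show "\<exists>p\<in>Sigma ?Q (\<lambda>C. C). v = snd p" by (intro bexI[of _ "(C, v)"]) auto
  qed
  have D: "D summable_on V" using div by (simp add: D_def)
  have "(\<lambda>(C, x). D x) summable_on Sigma ?Q (\<lambda>C. C)"
    using summable_on_reindex_bij_betw[OF bij, of D] D by (simp add: case_prod_unfold)
  then have "(\<Sum>\<^sub>\<infinity>C\<in>?Q. infsum D C) = infsum (\<lambda>(C, x). D x) (Sigma ?Q (\<lambda>C. C))"
    by (rule infsum_Sigma'_banach)
  also have "\<dots> = infsum D V"
    using infsum_reindex_bij_betw[OF bij, of D] by (simp add: case_prod_unfold)
  also have "(\<Sum>\<^sub>\<infinity>C\<in>?Q. infsum D C) = 0"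
  proof (rule infsum_0)
    fix C assume C: "C \<in> ?Q"
    have sub: "C \<subseteq> V" by (rule component_subset[OF C])
    interpret C: finite_degree_graph C b by (rule finite_degree_subgraph[OF sub])
    have inner: "(\<Sum>\<^sub>\<infinity>y\<in>C. F x y) = D x" if "x \<in> C" for x
      unfolding D_def
    proof (rule infsum_cong_neutral)
      fix y assume "y \<in> V - C"
      then show "F x y = 0"
        using bound[of x y] component_no_edge_out[OF C that] that sub by auto
    qed (use sub in auto)
    have "(\<Sum>\<^sub>\<infinity>x\<in>C. \<Sum>\<^sub>\<infinity>y\<in>C. F x y) = 0"
    proof (rule C.recurrent_flow_total_divergence)
      show "recurrent C b" by (rule rec[OF C])
      show "countable C" by (rule countable_component[OF C])
      show "(\<lambda>(x, y). b x y * (w x y)\<^sup>2) summable_on C \<times> C"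
        by (rule summable_on_subset[OF energy]) (use sub in auto)
      have "(\<lambda>x. \<Sum>\<^sub>\<infinity>y\<in>C. F x y) summable_on C \<longleftrightarrow> D summable_on C"
        by (rule summable_on_cong) (rule inner)
      then show "(\<lambda>x. \<Sum>\<^sub>\<infinity>y\<in>C. F x y) summable_on C"
        using summable_on_subset[OF D sub] by simp
      fix x y assume "x \<in> C" "y \<in> C"
      then have "x \<in> V" "y \<in> V" using sub by auto
      then show "F x y = - F y x" "cmod (F x y) \<le> b x y * w x y" by (fact antisym, fact bound)
    qed
    moreover have "(\<Sum>\<^sub>\<infinity>x\<in>C. \<Sum>\<^sub>\<infinity>y\<in>C. F x y) = infsum D C"
      by (rule infsum_cong) (rule inner)
    ultimately show "infsum D C = 0" by simp
  qed
  finally show ?thesis by (simp add: D_def)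
qed

end

section \<open>Incidence in a weighted simplicial complex\<close>

lemma face_iff: "\<tau> \<prec>\<^sub>f \<sigma> \<longleftrightarrow> (\<exists>v. v \<notin> \<tau> \<and> \<sigma> = insert v \<tau>)"
proof
  assume "\<tau> \<prec>\<^sub>f \<sigma>"
  then obtain v where "\<sigma> - \<tau> = {v}" and "\<tau> \<subseteq> \<sigma>"
    unfolding is_face_def by (metis card_1_singletonE)
  then show "\<exists>v. v \<notin> \<tau> \<and> \<sigma> = insert v \<tau>" by blast
next
  assume "\<exists>v. v \<notin> \<tau> \<and> \<sigma> = insert v \<tau>"
  then show "\<tau> \<prec>\<^sub>f \<sigma>" unfolding is_face_def by (auto simp: insert_Diff_if)
qed

lemma face_antisym: "\<tau> \<prec>\<^sub>f \<sigma> \<Longrightarrow> \<not> \<sigma> \<prec>\<^sub>f \<tau>"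
  by (auto simp: face_iff)

lemma indicator_fun_fin: "\<tau> \<in> S \<Longrightarrow> indicator {\<tau>} \<in> fun_fin S"
  by (auto simp: fun_fin_def fun_on_def indicator_def)

lemma fun_fin_fun_on: "\<omega> \<in> fun_fin S \<Longrightarrow> \<omega> \<in> fun_on S"
  by (simp add: fun_fin_def)

lemma fun_fin_l2: "\<omega> \<in> fun_fin S \<Longrightarrow> \<omega> \<in> l2 S m"
  unfolding l2_def fun_fin_def
  by (auto intro!: finite_nonzero_values_imp_summable_on elim: finite_subset[rotated])

lemma l2_fun_on: "\<omega> \<in> l2 S m \<Longrightarrow> \<omega> \<in> fun_on S"
  by (simp add: l2_def)

locale coboundary_complex =
  fixes X :: "'v set" and S :: "'v set set" and m :: "'v set \<Rightarrow> real"
    and \<delta> :: "'v cochain \<Rightarrow> 'v cochain"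
  assumes complex: "weighted_simplicial_complex X S m"
    and coboundary: "coboundary_operator S \<delta>"
begin

abbreviation incidence :: "'v set \<Rightarrow> 'v set \<Rightarrow> complex" ("\<theta>") where
  "\<theta> \<equiv> coeff_of \<delta>"

abbreviation bd :: "'v cochain \<Rightarrow> 'v cochain" ("\<partial>") where
  "\<partial> \<equiv> boundary S m \<delta>"

lemma weight_pos: "\<sigma> \<in> S \<Longrightarrow> 0 < m \<sigma>"
  using complex unfolding weighted_simplicial_complex_def by (auto split: if_splits)

lemma simplex_finite: "\<sigma> \<in> S \<Longrightarrow> finite \<sigma>"
  using complex unfolding weighted_simplicial_complex_def simplicial_complex_def by (auto split: if_splits)

lemma simplex_subset: "\<sigma> \<in> S \<Longrightarrow> \<sigma> \<subseteq> X"
  using complex unfolding weighted_simplicial_complex_def simplicial_complex_def by (auto split: if_splits)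

lemma coface_weights_summable: "\<tau> \<in> S \<Longrightarrow> m summable_on cofaces S \<tau>"
  using complex unfolding weighted_simplicial_complex_def by blast

text \<open>
  Only the empty simplex can be missing from \<open>S\<close>, and it is not missing if it lies
  above some \<open>\<tau> \<in> S\<close>.
\<close>

lemma simplex_between:
  assumes "\<tau> \<in> S" "\<sigma> \<in> S" "\<tau> \<subseteq> \<rho>" "\<rho> \<subseteq> \<sigma>"
  shows "\<rho> \<in> S"
proof -
  obtain K where K: "simplicial_complex X K"
    and S: "S = (if (\<lambda>x. m {x}) summable_on X then K else K - {{}})"
    using complex unfolding weighted_simplicial_complex_def by blast
  have "\<sigma> \<in> K" using assms S by (auto split: if_splits)
  then have "\<rho> \<in> K" using K assms(4) unfolding simplicial_complex_def by blast
  moreover have "\<rho> = {} \<Longrightarrow> {} \<in> S" using assms by auto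
  ultimately show ?thesis using S by (auto split: if_splits)
qed

lemma mem_link: "v \<in> link X S \<rho> \<longleftrightarrow> v \<notin> \<rho> \<and> insert v \<rho> \<in> S"
  using simplex_subset[of "insert v \<rho>"] unfolding link_def face_iff
  by (auto simp: insert_eq_iff)

lemma mem_cofaces: "\<sigma> \<in> cofaces S \<rho> \<longleftrightarrow> \<sigma> \<in> S \<and> \<rho> \<prec>\<^sub>f \<sigma>"
  by (simp add: cofaces_def)

lemma mem_faces: "\<rho> \<in> faces S \<sigma> \<longleftrightarrow> \<rho> \<in> S \<and> \<rho> \<prec>\<^sub>f \<sigma>"
  by (simp add: faces_def)

lemma finite_faces: "\<sigma> \<in> S \<Longrightarrow> finite (faces S \<sigma>)"
  by (rule finite_subset[of _ "Pow \<sigma>"]) (auto simp: faces_def is_face_def simplex_finite)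

lemma bij_link_cofaces: "bij_betw (\<lambda>v. insert v \<rho>) (link X S \<rho>) (cofaces S \<rho>)"
  by (rule bij_betwI') (auto simp: mem_link mem_cofaces face_iff)

lemma link_insert:
  assumes "\<tau> \<in> S" "v \<in> link X S \<tau>"
  shows "v' \<in> link X S (insert v \<tau>) \<longleftrightarrow> v' \<in> link X S \<tau> \<and> v \<noteq> v' \<and> insert v (insert v' \<tau>) \<in> S"
  using simplex_between[OF assms(1), of "insert v (insert v' \<tau>)" "insert v' \<tau>"] assms
  by (auto simp: mem_link insert_commute)

text \<open>
  The cofaces of \<open>v\<tau>\<close> are the simplices \<open>vv'\<tau>\<close> for the neighbours \<open>v'\<close> of \<open>v\<close> in the link graph of \<open>\<tau>\<close>. Sums over them
  are written over the whole link so that they become rows of a matrix indexed by the link.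
\<close>

lemma has_sum_link_row:
  fixes g :: "'v set \<Rightarrow> 'c::topological_comm_monoid_add"
  assumes "\<tau> \<in> S" "v \<in> link X S \<tau>"
  shows "((\<lambda>v'. if v \<noteq> v' \<and> insert v (insert v' \<tau>) \<in> S then g (insert v (insert v' \<tau>)) else 0) has_sum s)
           (link X S \<tau>) \<longleftrightarrow> (g has_sum s) (cofaces S (insert v \<tau>))"
proof -
  have "(g has_sum s) (cofaces S (insert v \<tau>)) \<longleftrightarrow>
      ((\<lambda>v'. g (insert v' (insert v \<tau>))) has_sum s) (link X S (insert v \<tau>))"
    by (rule has_sum_reindex_bij_betw[OF bij_link_cofaces, symmetric])
  also have "\<dots> \<longleftrightarrow> ((\<lambda>v'. if v \<noteq> v' \<and> insert v (insert v' \<tau>) \<in> S then g (insert v (insert v' \<tau>)) else 0) has_sum s)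
           (link X S \<tau>)"
    by (rule has_sum_cong_neutral) (auto simp: link_insert[OF assms] insert_commute)
  finally show ?thesis by simp
qed

lemma incidence_cases: "\<tau> \<in> S \<Longrightarrow> \<sigma> \<in> S \<Longrightarrow> \<tau> \<prec>\<^sub>f \<sigma> \<Longrightarrow> \<theta> \<tau> \<sigma> = 1 \<or> \<theta> \<tau> \<sigma> = -1"
  using coboundary unfolding coboundary_operator_def by auto

lemma norm_incidence: "\<tau> \<in> S \<Longrightarrow> \<sigma> \<in> S \<Longrightarrow> \<tau> \<prec>\<^sub>f \<sigma> \<Longrightarrow> cmod (\<theta> \<tau> \<sigma>) = 1"
  using incidence_cases by fastforce

lemma cnj_incidence: "\<tau> \<in> S \<Longrightarrow> \<sigma> \<in> S \<Longrightarrow> \<tau> \<prec>\<^sub>f \<sigma> \<Longrightarrow> cnj (\<theta> \<tau> \<sigma>) = \<theta> \<tau> \<sigma>"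
  using incidence_cases by fastforce

lemma coboundary_fun_on: "\<omega> \<in> fun_on S \<Longrightarrow> \<delta> \<omega> \<in> fun_on S"
  using coboundary unfolding coboundary_operator_def by blast

lemma coboundary_apply:
  "\<omega> \<in> fun_on S \<Longrightarrow> \<sigma> \<in> S \<Longrightarrow> \<delta> \<omega> \<sigma> = (\<Sum>\<tau>\<in>faces S \<sigma>. \<theta> \<tau> \<sigma> * \<omega> \<tau>)"
  using coboundary unfolding coboundary_operator_def by blast

lemma coboundary_outside: "\<omega> \<in> fun_on S \<Longrightarrow> \<sigma> \<notin> S \<Longrightarrow> \<delta> \<omega> \<sigma> = 0"
  using coboundary_fun_on unfolding fun_on_def by blast

lemma coboundary_coboundary: "\<omega> \<in> fun_on S \<Longrightarrow> \<delta> (\<delta> \<omega>) = 0"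
  using coboundary unfolding coboundary_operator_def by blast

lemma incidence_eq_0:
  assumes "\<tau> \<in> S" "\<sigma> \<in> S" "\<not> \<tau> \<prec>\<^sub>f \<sigma>"
  shows "\<theta> \<tau> \<sigma> = 0"
proof -
  have "\<theta> \<tau> \<sigma> = \<delta> (indicator {\<tau>}) \<sigma>" by (simp add: coeff_of_def)
  also have "\<dots> = (\<Sum>\<rho>\<in>faces S \<sigma>. \<theta> \<rho> \<sigma> * indicator {\<tau>} \<rho>)"
    by (rule coboundary_apply) (use assms in \<open>auto intro: fun_fin_fun_on indicator_fun_fin\<close>)
  also have "\<dots> = 0"
    using assms by (intro sum.neutral) (auto simp: mem_faces indicator_def)
  finally show ?thesis .
qed

lemma coboundary_indicator:
  assumes "\<tau> \<in> S"
  shows "\<delta> (indicator {\<tau>}) = (\<lambda>\<sigma>. if \<sigma> \<in> cofaces S \<tau> then \<theta> \<tau> \<sigma> else 0)"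
proof
  fix \<sigma> show "\<delta> (indicator {\<tau>}) \<sigma> = (if \<sigma> \<in> cofaces S \<tau> then \<theta> \<tau> \<sigma> else 0)"
    using assms incidence_eq_0[OF assms, of \<sigma>] coboundary_outside[OF fun_fin_fun_on[OF indicator_fun_fin[OF assms]], of \<sigma>]
    by (cases "\<sigma> \<in> S") (auto simp: mem_cofaces coeff_of_def)
qed

text \<open>
  Only the two intermediate simplices \<open>v\<tau>\<close> and \<open>v'\<tau>\<close> contribute to \<open>\<delta> \<delta> 1\<^sub>\<tau> = 0\<close> at \<open>vv'\<tau>\<close>, hence their contributions
  cancel. This is the source of the antisymmetry of the flow on the link.
\<close>

lemma incidence_two_step:
  assumes "\<tau> \<in> S" "v \<in> link X S \<tau>" "v' \<in> link X S \<tau>" "v \<noteq> v'" "insert v (insert v' \<tau>) \<in> S"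
  defines "\<kappa> \<equiv> insert v (insert v' \<tau>)"
  shows "\<theta> \<tau> (insert v \<tau>) * \<theta> (insert v \<tau>) \<kappa> = - (\<theta> \<tau> (insert v' \<tau>) * \<theta> (insert v' \<tau>) \<kappa>)"
proof -
  have \<kappa>: "\<kappa> \<in> S" using assms by simp
  have ind: "indicator {\<tau>} \<in> fun_on S" using assms(1) by (intro fun_fin_fun_on indicator_fun_fin)
  have "0 = \<delta> (\<delta> (indicator {\<tau>})) \<kappa>" using coboundary_coboundary[OF ind] by simp
  also have "\<dots> = (\<Sum>\<sigma>\<in>faces S \<kappa>. \<theta> \<sigma> \<kappa> * \<delta> (indicator {\<tau>}) \<sigma>)"
    by (rule coboundary_apply[OF coboundary_fun_on[OF ind] \<kappa>])
  also have "\<dots> = (\<Sum>\<sigma>\<in>{insert v \<tau>, insert v' \<tau>}. \<theta> \<sigma> \<kappa> * \<delta> (indicator {\<tau>}) \<sigma>)"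
  proof (rule sum.mono_neutral_right)
    show "finite (faces S \<kappa>)" by (rule finite_faces[OF \<kappa>])
    show "{insert v \<tau>, insert v' \<tau>} \<subseteq> faces S \<kappa>"
      using assms(1-4) by (auto simp: mem_faces mem_link face_iff \<kappa>_def insert_commute)
    show "\<forall>\<sigma>\<in>faces S \<kappa> - {insert v \<tau>, insert v' \<tau>}. \<theta> \<sigma> \<kappa> * \<delta> (indicator {\<tau>}) \<sigma> = 0"
    proof
      fix \<sigma> assume \<sigma>: "\<sigma> \<in> faces S \<kappa> - {insert v \<tau>, insert v' \<tau>}"
      have "\<sigma> \<notin> cofaces S \<tau>"
      proof
        assume "\<sigma> \<in> cofaces S \<tau>"
        then obtain u where u: "u \<notin> \<tau>" "\<sigma> = insert u \<tau>" by (auto simp: mem_cofaces face_iff)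
        with \<sigma> have "u \<noteq> v" "u \<noteq> v'" "u \<in> \<kappa>" by (auto simp: mem_faces is_face_def)
        then show False using u by (auto simp: \<kappa>_def)
      qed
      then show "\<theta> \<sigma> \<kappa> * \<delta> (indicator {\<tau>}) \<sigma> = 0" by (simp add: coboundary_indicator[OF assms(1)])
    qed
  qed
  also have "\<dots> = \<theta> (insert v \<tau>) \<kappa> * \<theta> \<tau> (insert v \<tau>) + \<theta> (insert v' \<tau>) \<kappa> * \<theta> \<tau> (insert v' \<tau>)"
    using assms(2-4) by (subst sum.insert) (auto simp: coeff_of_def mem_link)
  finally show ?thesis by (simp add: mult.commute eq_neg_iff_add_eq_0)
qed

section \<open>Boundaries of square summable cochains\<close>

lemma l2_subset_boundary_dom:
  assumes \<omega>: "\<omega> \<in> l2 S m"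
  shows "\<omega> \<in> boundary_dom S m"
proof -
  have "(\<lambda>\<sigma>. m \<sigma> * cmod (\<omega> \<sigma>)) summable_on cofaces S \<rho>" if "\<rho> \<in> S" for \<rho>
  proof (rule summable_on_comparison_test)
    have "(\<lambda>\<sigma>. m \<sigma> * (cmod (\<omega> \<sigma>))\<^sup>2) summable_on cofaces S \<rho>"
      by (rule summable_on_subset[of _ S]) (use \<omega> in \<open>auto simp: l2_def cofaces_def\<close>)
    then show "(\<lambda>\<sigma>. (m \<sigma> + m \<sigma> * (cmod (\<omega> \<sigma>))\<^sup>2) * (1/2)) summable_on cofaces S \<rho>"
      by (intro summable_on_cmult_left summable_on_add coface_weights_summable that)
    fix \<sigma> assume "\<sigma> \<in> cofaces S \<rho>"
    then have m: "0 < m \<sigma>" by (auto simp: mem_cofaces weight_pos)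
    then show "m \<sigma> * cmod (\<omega> \<sigma>) \<le> (m \<sigma> + m \<sigma> * (cmod (\<omega> \<sigma>))\<^sup>2) * (1/2)"
      using weighted_le_sum_squares[of "m \<sigma>" 1 1 "cmod (\<omega> \<sigma>)"] by simp
    show "0 \<le> m \<sigma> * cmod (\<omega> \<sigma>)" using m by simp
  qed
  then show ?thesis using \<omega> by (auto simp: boundary_dom_def l2_def)
qed

lemma boundary_has_sum:
  assumes \<omega>: "\<omega> \<in> boundary_dom S m" and \<rho>: "\<rho> \<in> S"
  shows "((\<lambda>\<tau>. of_real (m \<tau>) * \<theta> \<rho> \<tau> * \<omega> \<tau>) has_sum of_real (m \<rho>) * \<partial> \<omega> \<rho>) (cofaces S \<rho>)"
proof -
  have "(\<lambda>\<tau>. of_real (m \<tau>) * \<theta> \<rho> \<tau> * \<omega> \<tau>) summable_on cofaces S \<rho>"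
  proof (rule abs_summable_summable[OF Infinite_Sum.abs_summable_on_comparison_test'])
    show "(\<lambda>\<tau>. m \<tau> * cmod (\<omega> \<tau>)) summable_on cofaces S \<rho>"
      using \<omega> \<rho> by (simp add: boundary_dom_def)
    fix \<tau> assume "\<tau> \<in> cofaces S \<rho>"
    then show "cmod (of_real (m \<tau>) * \<theta> \<rho> \<tau> * \<omega> \<tau>) \<le> m \<tau> * cmod (\<omega> \<tau>)"
      using \<rho> weight_pos[of \<tau>] by (simp add: mem_cofaces norm_mult norm_incidence)
  qed
  moreover have "of_real (m \<rho>) * \<partial> \<omega> \<rho> = (\<Sum>\<^sub>\<infinity>\<tau>\<in>cofaces S \<rho>. of_real (m \<tau>) * \<theta> \<rho> \<tau> * \<omega> \<tau>)"
    using weight_pos[OF \<rho>] \<rho> by (simp add: boundary_def)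
  ultimately show ?thesis by simp
qed

lemma boundary_eqI:
  assumes "\<rho> \<in> S" "((\<lambda>\<tau>. of_real (m \<tau>) * \<theta> \<rho> \<tau> * \<omega> \<tau>) has_sum of_real (m \<rho>) * s) (cofaces S \<rho>)"
  shows "\<partial> \<omega> \<rho> = s"
  using weight_pos[OF assms(1)] assms(1) infsumI[OF assms(2)] by (simp add: boundary_def)

lemma boundary_outside: "\<rho> \<notin> S \<Longrightarrow> \<partial> \<omega> \<rho> = 0"
  by (simp add: boundary_def)

lemma boundary_fun_on: "\<partial> \<omega> \<in> fun_on S"
  by (simp add: fun_on_def boundary_outside)

lemma boundary_lincomb:
  assumes "\<omega> \<in> boundary_dom S m" "\<eta> \<in> boundary_dom S m"
  shows "\<partial> (\<omega> + cscale c \<eta>) = \<partial> \<omega> + cscale c (\<partial> \<eta>)"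
proof
  fix \<rho> show "\<partial> (\<omega> + cscale c \<eta>) \<rho> = (\<partial> \<omega> + cscale c (\<partial> \<eta>)) \<rho>"
  proof (cases "\<rho> \<in> S")
    case True
    have "((\<lambda>\<tau>. of_real (m \<tau>) * \<theta> \<rho> \<tau> * \<omega> \<tau> + c * (of_real (m \<tau>) * \<theta> \<rho> \<tau> * \<eta> \<tau>)) has_sum
        of_real (m \<rho>) * \<partial> \<omega> \<rho> + c * (of_real (m \<rho>) * \<partial> \<eta> \<rho>)) (cofaces S \<rho>)"
      by (intro has_sum_add has_sum_cmult_right boundary_has_sum assms True)
    then show ?thesis
      by (intro boundary_eqI[OF True]) (simp add: cscale_def algebra_simps)
  qed (simp add: boundary_outside cscale_def)
qed

lemma coboundary_lincomb:
  assumes "\<omega> \<in> fun_on S" "\<eta> \<in> fun_on S"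
  shows "\<delta> (\<omega> + cscale c \<eta>) = \<delta> \<omega> + cscale c (\<delta> \<eta>)"
proof
  have sum: "\<omega> + cscale c \<eta> \<in> fun_on S" using assms by (simp add: fun_on_def cscale_def)
  fix \<sigma> show "\<delta> (\<omega> + cscale c \<eta>) \<sigma> = (\<delta> \<omega> + cscale c (\<delta> \<eta>)) \<sigma>"
  proof (cases "\<sigma> \<in> S")
    case True
    have "\<delta> (\<omega> + cscale c \<eta>) \<sigma> = (\<Sum>\<tau>\<in>faces S \<sigma>. \<theta> \<tau> \<sigma> * (\<omega> + cscale c \<eta>) \<tau>)"
      by (rule coboundary_apply[OF sum True])
    also have "\<dots> = \<delta> \<omega> \<sigma> + c * \<delta> \<eta> \<sigma>"
      by (simp add: coboundary_apply[OF assms(1) True] coboundary_apply[OF assms(2) True]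
          cscale_def distrib_left sum.distrib sum_distrib_left mult_ac)
    also have "\<dots> = (\<delta> \<omega> + cscale c (\<delta> \<eta>)) \<sigma>" by (simp add: cscale_def)
    finally show ?thesis .
  next
    case False
    then show ?thesis
      using coboundary_outside[OF sum False] by (simp add: coboundary_outside assms cscale_def)
  qed
qed

lemma boundary_indicator:
  assumes \<tau>: "\<tau> \<in> S" and \<rho>: "\<rho> \<in> S"
  shows "of_real (m \<rho>) * \<partial> (indicator {\<tau>}) \<rho> = (if \<rho> \<prec>\<^sub>f \<tau> then of_real (m \<tau>) * \<theta> \<rho> \<tau> else 0)"
proof (rule has_sum_unique)
  show "((\<lambda>\<sigma>. of_real (m \<sigma>) * \<theta> \<rho> \<sigma> * indicator {\<tau>} \<sigma>) has_sum
      of_real (m \<rho>) * \<partial> (indicator {\<tau>}) \<rho>) (cofaces S \<rho>)"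
    by (intro boundary_has_sum l2_subset_boundary_dom fun_fin_l2 indicator_fun_fin \<tau> \<rho>)
  show "((\<lambda>\<sigma>. of_real (m \<sigma>) * \<theta> \<rho> \<sigma> * indicator {\<tau>} \<sigma>) has_sum
      (if \<rho> \<prec>\<^sub>f \<tau> then of_real (m \<tau>) * \<theta> \<rho> \<tau> else 0)) (cofaces S \<rho>)"
    by (rule has_sum_finite_neutralI[of "{\<tau>} \<inter> cofaces S \<rho>"])
       (use \<tau> in \<open>auto simp: indicator_def mem_cofaces Int_insert_left\<close>)
qed

lemma union_face:
  assumes "\<rho> \<prec>\<^sub>f \<sigma>" "\<tau> \<prec>\<^sub>f \<sigma>" "\<rho> \<noteq> \<tau>"
  shows "\<sigma> = \<rho> \<union> \<tau>"
proof -
  obtain u where u: "u \<notin> \<rho>" "\<sigma> = insert u \<rho>" using assms(1) unfolding face_iff by blast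
  obtain v where v: "v \<notin> \<tau>" "\<sigma> = insert v \<tau>" using assms(2) unfolding face_iff by blast
  have "u \<noteq> v" using insert_ident[of u \<rho> \<tau>] u v assms(3) by auto
  then show ?thesis using u v by auto
qed

text \<open>
  Two different faces determine their common coface as their union, so a single term survives in the
  sum defining the boundary.
\<close>

lemma boundary_coboundary_indicator:
  assumes \<tau>: "\<tau> \<in> S" and \<rho>: "\<rho> \<in> S" and \<sigma>: "\<sigma> \<in> S" "\<tau> \<prec>\<^sub>f \<sigma>" "\<rho> \<prec>\<^sub>f \<sigma>" and ne: "\<rho> \<noteq> \<tau>"
  shows "cmod (\<partial> (\<delta> (indicator {\<tau>})) \<rho>) = m \<sigma> / m \<rho>"
proof -
  have "((\<lambda>\<kappa>. of_real (m \<kappa>) * \<theta> \<rho> \<kappa> * \<delta> (indicator {\<tau>}) \<kappa>) has_sum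
      (of_real (m \<sigma>) * \<theta> \<rho> \<sigma> * \<theta> \<tau> \<sigma>)) (cofaces S \<rho>)"
  proof (rule has_sum_finite_neutralI[of "{\<sigma>}"])
    fix \<kappa> assume "\<kappa> \<in> cofaces S \<rho> - {\<sigma>}"
    then have "\<not> \<tau> \<prec>\<^sub>f \<kappa>"
      using union_face[of \<rho> \<kappa> \<tau>] union_face[of \<rho> \<sigma> \<tau>] \<sigma> ne by (auto simp: mem_cofaces)
    then show "of_real (m \<kappa>) * \<theta> \<rho> \<kappa> * \<delta> (indicator {\<tau>}) \<kappa> = 0"
      by (simp add: coboundary_indicator \<tau> mem_cofaces)
  qed (use \<sigma> in \<open>auto simp: mem_cofaces coeff_of_def\<close>)
  then have "\<partial> (\<delta> (indicator {\<tau>})) \<rho> = of_real (m \<sigma>) * \<theta> \<rho> \<sigma> * \<theta> \<tau> \<sigma> / of_real (m \<rho>)"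
    using weight_pos[OF \<rho>] by (intro boundary_eqI[OF \<rho>]) simp
  then show ?thesis
    using \<tau> \<rho> \<sigma> weight_pos[OF \<rho>] weight_pos[OF \<sigma>(1)] by (simp add: norm_mult norm_divide norm_incidence)
qed

text \<open>
  A coface \<open>\<sigma>\<close> of \<open>\<tau>\<close> contributes \<open>m(\<sigma>) |\<omega>(\<rho>)|\<close> for each of its faces \<open>\<rho>\<close>. For \<open>\<rho> = \<tau>\<close> this is local summability.
  For \<open>\<rho> \<noteq> \<tau>\<close> it equals \<open>m(\<rho>) |\<partial> \<delta> 1\<^sub>\<tau>(\<rho>)| |\<omega>(\<rho>)|\<close>, a term of the pairing of two functions in \<open>l\<^sup>2\<close>, and \<open>\<rho>\<close> occurs for one \<open>\<sigma>\<close> only.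
\<close>

lemma coboundary_in_boundary_dom:
  assumes \<omega>: "\<omega> \<in> l2 S m"
    and bc: "\<And>\<tau>. \<tau> \<in> S \<Longrightarrow> \<partial> (\<delta> (indicator {\<tau>})) \<in> l2 S m"
  shows "\<delta> \<omega> \<in> boundary_dom S m"
proof -
  have \<omega>on: "\<omega> \<in> fun_on S" by (rule l2_fun_on[OF \<omega>])
  have "(\<lambda>\<sigma>. m \<sigma> * cmod (\<delta> \<omega> \<sigma>)) summable_on cofaces S \<tau>" if \<tau>: "\<tau> \<in> S" for \<tau>
  proof -
    define N where "N = Sigma (cofaces S \<tau>) (\<lambda>\<sigma>. faces S \<sigma> - {\<tau>})"
    define h where "h \<rho> = (m \<rho> * (cmod (\<partial> (\<delta> (indicator {\<tau>})) \<rho>))\<^sup>2 + m \<rho> * (cmod (\<omega> \<rho>))\<^sup>2) * (1/2)" for \<rho>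
    have h: "h summable_on S"
      unfolding h_def using bc[OF \<tau>] \<omega>
      by (intro summable_on_cmult_left summable_on_add) (simp_all add: l2_def)
    have inj: "inj_on snd N"
    proof (rule inj_onI)
      fix p q assume pq: "p \<in> N" "q \<in> N" "snd p = snd q"
      have "fst p = snd p \<union> \<tau>" if "p \<in> N" for p
        using that by (intro union_face) (auto simp: N_def mem_cofaces mem_faces)
      with pq show "p = q" by (simp add: prod_eq_iff)
    qed
    have "h summable_on snd ` N"
      by (rule summable_on_subset[OF h]) (auto simp: N_def mem_faces)
    then have hN: "(\<lambda>p. h (snd p)) summable_on N"
      using summable_on_reindex[OF inj, of h] by (simp add: o_def)
    have "(\<lambda>(\<sigma>, \<rho>). m \<sigma> * cmod (\<omega> \<rho>)) summable_on N"
    proof (rule summable_on_comparison_test[OF hN])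
      fix p assume pN: "p \<in> N"
      obtain \<sigma> \<rho> where p: "p = (\<sigma>, \<rho>)" by (cases p)
      then have \<sigma>: "\<sigma> \<in> S" "\<tau> \<prec>\<^sub>f \<sigma>" "\<rho> \<prec>\<^sub>f \<sigma>" "\<rho> \<noteq> \<tau>" "\<rho> \<in> S"
        using pN by (auto simp: N_def mem_cofaces mem_faces)
      have pos: "0 < m \<rho>" "0 < m \<sigma>" using \<sigma> weight_pos by auto
      have "m \<sigma> = m \<rho> * cmod (\<partial> (\<delta> (indicator {\<tau>})) \<rho>)"
        using boundary_coboundary_indicator[OF \<tau> \<sigma>(5,1,2,3,4)] pos by simp
      then have "m \<sigma> * cmod (\<omega> \<rho>) = m \<rho> * (cmod (\<partial> (\<delta> (indicator {\<tau>})) \<rho>) * cmod (\<omega> \<rho>))"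
        by simp
      also have "\<dots> \<le> h \<rho>"
        using weighted_le_sum_squares[of "m \<rho>" 1 "cmod (\<partial> (\<delta> (indicator {\<tau>})) \<rho>)" "cmod (\<omega> \<rho>)"] pos
        by (simp add: h_def)
      finally show "(case p of (\<sigma>, \<rho>) \<Rightarrow> m \<sigma> * cmod (\<omega> \<rho>)) \<le> h (snd p)" by (simp add: p)
      show "0 \<le> (case p of (\<sigma>, \<rho>) \<Rightarrow> m \<sigma> * cmod (\<omega> \<rho>))" using pos by (simp add: p)
    qed
    then have "(\<lambda>\<sigma>. \<Sum>\<^sub>\<infinity>\<rho>\<in>faces S \<sigma> - {\<tau>}. m \<sigma> * cmod (\<omega> \<rho>)) summable_on cofaces S \<tau>"
      unfolding N_def by (rule summable_on_Sigma_banach)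
    moreover have "(\<lambda>\<sigma>. m \<sigma> * cmod (\<omega> \<tau>)) summable_on cofaces S \<tau>"
      by (intro summable_on_cmult_left coface_weights_summable \<tau>)
    ultimately have "(\<lambda>\<sigma>. m \<sigma> * cmod (\<omega> \<tau>) + (\<Sum>\<^sub>\<infinity>\<rho>\<in>faces S \<sigma> - {\<tau>}. m \<sigma> * cmod (\<omega> \<rho>)))
        summable_on cofaces S \<tau>"
      by (intro summable_on_add)
    then show ?thesis
    proof (rule summable_on_comparison_test)
      fix \<sigma> assume "\<sigma> \<in> cofaces S \<tau>"
      then have \<sigma>: "\<sigma> \<in> S" "\<tau> \<prec>\<^sub>f \<sigma>" by (auto simp: mem_cofaces)
      have m: "0 < m \<sigma>" by (rule weight_pos[OF \<sigma>(1)])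
      then show "0 \<le> m \<sigma> * cmod (\<delta> \<omega> \<sigma>)" by simp
      have "cmod (\<delta> \<omega> \<sigma>) \<le> (\<Sum>\<rho>\<in>faces S \<sigma>. cmod (\<theta> \<rho> \<sigma> * \<omega> \<rho>))"
        unfolding coboundary_apply[OF \<omega>on \<sigma>(1)] by (rule norm_sum)
      also have "\<dots> = (\<Sum>\<rho>\<in>faces S \<sigma>. cmod (\<omega> \<rho>))"
        using \<sigma> by (intro sum.cong) (auto simp: mem_faces norm_mult norm_incidence)
      also have "\<dots> = cmod (\<omega> \<tau>) + (\<Sum>\<rho>\<in>faces S \<sigma> - {\<tau>}. cmod (\<omega> \<rho>))"
        using \<tau> \<sigma> by (intro sum.remove finite_faces) (auto simp: mem_faces)
      finally have "m \<sigma> * cmod (\<delta> \<omega> \<sigma>) \<le> m \<sigma> * \<dots>" using m by simp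
      then show "m \<sigma> * cmod (\<delta> \<omega> \<sigma>) \<le> m \<sigma> * cmod (\<omega> \<tau>) + (\<Sum>\<^sub>\<infinity>\<rho>\<in>faces S \<sigma> - {\<tau>}. m \<sigma> * cmod (\<omega> \<rho>))"
        using finite_faces[OF \<sigma>(1)] by (simp add: distrib_left sum_distrib_left)
    qed
  qed
  then show ?thesis using coboundary_fun_on[OF \<omega>on] by (simp add: boundary_dom_def)
qed

lemma link_graph_finite_degree:
  assumes \<tau>: "\<tau> \<in> S"
  shows "finite_degree_graph (link X S \<tau>) (link_graph S m \<tau>)"
proof
  fix v assume v: "v \<in> link X S \<tau>"
  then have "m summable_on cofaces S (insert v \<tau>)" by (intro coface_weights_summable) (simp add: mem_link)
  then show "link_graph S m \<tau> v summable_on link X S \<tau>"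
    unfolding link_graph_def[abs_def] summable_on_def using has_sum_link_row[OF \<tau> v, of m] by simp
qed (auto simp: link_graph_def weight_pos less_imp_le insert_commute)

text \<open>
  The energy is the sum of \<open>m |\<omega>|\<^sup>2\<close> over the simplices of the form \<open>vv'\<tau>\<close>, each counted twice. Sending \<open>(v, v')\<close> to
  \<open>(vv'\<tau>, v)\<close> turns the count into a sum over the two vertices of such a simplex outside \<open>\<tau>\<close>.
\<close>

lemma link_flow_energy_summable:
  assumes \<tau>: "\<tau> \<in> S" and \<omega>: "\<omega> \<in> l2 S m"
  shows "(\<lambda>(v, v'). link_graph S m \<tau> v v' * (cmod (\<omega> (insert v (insert v' \<tau>))))\<^sup>2)
           summable_on link X S \<tau> \<times> link X S \<tau>"
proof -
  define g where "g \<kappa> = m \<kappa> * (cmod (\<omega> \<kappa>))\<^sup>2" for \<kappa>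
  define L where "L = {\<kappa>\<in>S. card (\<kappa> - \<tau>) = 2}"
  define A where "A = {(v, v') \<in> link X S \<tau> \<times> link X S \<tau>. v \<noteq> v' \<and> insert v (insert v' \<tau>) \<in> S}"
  define f where "f = (\<lambda>(v, v'). (insert v (insert v' \<tau>), v))"
  have g: "g summable_on S" using \<omega> by (simp add: g_def[abs_def] l2_def)
  have "(\<lambda>p. g (fst p)) summable_on Sigma L (\<lambda>\<kappa>. \<kappa> - \<tau>)"
  proof (rule summable_on_SigmaI)
    fix \<kappa> assume \<kappa>: "\<kappa> \<in> L"
    then have "finite (\<kappa> - \<tau>)" by (simp add: L_def simplex_finite)
    then show "((\<lambda>v. g (fst (\<kappa>, v))) has_sum 2 * g \<kappa>) (\<kappa> - \<tau>)"
      using \<kappa> by (intro has_sum_finiteI) (simp_all add: L_def)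
    show "0 \<le> g (fst (\<kappa>, v))" for v using \<kappa> weight_pos[of \<kappa>] by (simp add: g_def L_def)
  next
    show "(\<lambda>\<kappa>. 2 * g \<kappa>) summable_on L"
      by (intro summable_on_cmult_right summable_on_subset[OF g]) (auto simp: L_def)
  qed
  then have "(\<lambda>p. g (fst p)) summable_on f ` A"
    by (rule summable_on_subset) (auto simp: f_def A_def L_def mem_link insert_Diff_if)
  moreover have "inj_on f A"
  proof (rule inj_onI)
    fix p q assume pq: "p \<in> A" "q \<in> A" "f p = f q"
    obtain v v' u u' where p: "p = (v, v')" and q: "q = (u, u')" by (cases p, cases q) auto
    have uv: "u = v" and eq: "insert v (insert v' \<tau>) = insert v (insert u' \<tau>)"
      using pq(3) unfolding p q f_def by auto
    have "v' \<notin> insert v \<tau>" "u' \<notin> insert v \<tau>"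
      using pq(1,2) uv unfolding p q A_def by (auto simp: mem_link)
    moreover have "v' \<in> insert v (insert u' \<tau>)" by (simp flip: eq)
    ultimately have "v' = u'" by simp
    then show "p = q" using p q uv by simp
  qed
  ultimately have "((\<lambda>p. g (fst p)) \<circ> f) summable_on A"
    by (simp add: summable_on_reindex)
  also have "((\<lambda>p. g (fst p)) \<circ> f) summable_on A \<longleftrightarrow> ?thesis"
  proof (rule summable_on_cong_neutral)
    fix p assume "p \<in> link X S \<tau> \<times> link X S \<tau> - A"
    then show "(case p of (v, v') \<Rightarrow> link_graph S m \<tau> v v' * (cmod (\<omega> (insert v (insert v' \<tau>))))\<^sup>2) = 0"
      by (auto simp: A_def link_graph_def split: if_splits)
  next
    fix p assume "p \<in> A \<inter> link X S \<tau> \<times> link X S \<tau>"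
    then show "((\<lambda>p. g (fst p)) \<circ> f) p =
        (case p of (v, v') \<Rightarrow> link_graph S m \<tau> v v' * (cmod (\<omega> (insert v (insert v' \<tau>))))\<^sup>2)"
      by (auto simp: A_def f_def g_def link_graph_def)
  qed (auto simp: A_def)
  finally show ?thesis .
qed

text \<open>
  Pulled back to the link of \<open>\<tau>\<close>, the double sum defining \<open>\<partial> \<partial> \<omega>\<close> at \<open>\<tau>\<close> is the total divergence of an antisymmetric
  flow \<open>F\<close> of finite energy. Its row sums converge absolutely since \<open>\<omega> \<in> l\<^sup>2\<close>, but the order of summation cannot be
  exchanged in general; this is where recurrence enters.
\<close>

lemma boundary_boundary:
  assumes \<omega>: "\<omega> \<in> l2 S m" and dom: "\<partial> \<omega> \<in> boundary_dom S m" and \<tau>: "\<tau> \<in> S"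
    and rec: "\<And>C. C \<in> graph_components (link X S \<tau>) (link_graph S m \<tau>) \<Longrightarrow> recurrent C (link_graph S m \<tau>)"
  shows "\<partial> (\<partial> \<omega>) \<tau> = 0"
proof -
  interpret G: finite_degree_graph "link X S \<tau>" "link_graph S m \<tau>"
    by (rule link_graph_finite_degree[OF \<tau>])
  define F where "F v v' = (if v \<noteq> v' \<and> insert v (insert v' \<tau>) \<in> S
      then \<theta> \<tau> (insert v \<tau>) * (of_real (m (insert v (insert v' \<tau>))) *
           \<theta> (insert v \<tau>) (insert v (insert v' \<tau>)) * \<omega> (insert v (insert v' \<tau>))) else 0)" for v v'
  have row: "(F v has_sum \<theta> \<tau> (insert v \<tau>) * (of_real (m (insert v \<tau>)) * \<partial> \<omega> (insert v \<tau>))) (link X S \<tau>)"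
    if v: "v \<in> link X S \<tau>" for v
  proof -
    have vS: "insert v \<tau> \<in> S" using v by (simp add: mem_link)
    have "((\<lambda>\<kappa>. \<theta> \<tau> (insert v \<tau>) * (of_real (m \<kappa>) * \<theta> (insert v \<tau>) \<kappa> * \<omega> \<kappa>)) has_sum
        \<theta> \<tau> (insert v \<tau>) * (of_real (m (insert v \<tau>)) * \<partial> \<omega> (insert v \<tau>))) (cofaces S (insert v \<tau>))"
      by (intro has_sum_cmult_right boundary_has_sum l2_subset_boundary_dom \<omega> vS)
    then show ?thesis
      unfolding F_def[abs_def] by (rule has_sum_link_row[OF \<tau> v, THEN iffD2])
  qed
  have "((\<lambda>\<sigma>. of_real (m \<sigma>) * \<theta> \<tau> \<sigma> * \<partial> \<omega> \<sigma>) has_sum of_real (m \<tau>) * \<partial> (\<partial> \<omega>) \<tau>) (cofaces S \<tau>)"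
    by (rule boundary_has_sum[OF dom \<tau>])
  then have total: "((\<lambda>v. of_real (m (insert v \<tau>)) * \<theta> \<tau> (insert v \<tau>) * \<partial> \<omega> (insert v \<tau>)) has_sum
      of_real (m \<tau>) * \<partial> (\<partial> \<omega>) \<tau>) (link X S \<tau>)"
    by (subst has_sum_reindex_bij_betw[OF bij_link_cofaces])
  have "((\<lambda>v. \<Sum>\<^sub>\<infinity>v'\<in>link X S \<tau>. F v v') has_sum of_real (m \<tau>) * \<partial> (\<partial> \<omega>) \<tau>) (link X S \<tau>)"
    by (rule has_sum_cong[THEN iffD1, OF _ total]) (simp add: infsumI[OF row])
  moreover have "(\<Sum>\<^sub>\<infinity>v\<in>link X S \<tau>. \<Sum>\<^sub>\<infinity>v'\<in>link X S \<tau>. F v v') = 0"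
  proof (rule G.flow_total_divergence[OF rec])
    fix v v' assume vv: "v \<in> link X S \<tau>" "v' \<in> link X S \<tau>"
    show "F v v' = - F v' v"
    proof (cases "v \<noteq> v' \<and> insert v (insert v' \<tau>) \<in> S")
      case True
      define \<kappa> where "\<kappa> = insert v (insert v' \<tau>)"
      have \<kappa>': "insert v' (insert v \<tau>) = \<kappa>" by (auto simp: \<kappa>_def)
      have "F v v' = \<theta> \<tau> (insert v \<tau>) * \<theta> (insert v \<tau>) \<kappa> * (of_real (m \<kappa>) * \<omega> \<kappa>)"
        using True by (auto simp: F_def mult_ac simp flip: \<kappa>_def)
      also have "\<theta> \<tau> (insert v \<tau>) * \<theta> (insert v \<tau>) \<kappa> = - (\<theta> \<tau> (insert v' \<tau>) * \<theta> (insert v' \<tau>) \<kappa>)"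
        using True unfolding \<kappa>_def by (intro incidence_two_step \<tau> vv) auto
      also have "\<dots> * (of_real (m \<kappa>) * \<omega> \<kappa>) = - F v' v"
        using True by (auto simp: F_def mult_ac \<kappa>' simp flip: \<kappa>_def)
      finally show ?thesis .
    qed (auto simp: F_def insert_commute)
    show "cmod (F v v') \<le> link_graph S m \<tau> v v' * cmod (\<omega> (insert v (insert v' \<tau>)))"
    proof (cases "v \<noteq> v' \<and> insert v (insert v' \<tau>) \<in> S")
      case True
      have "cmod (\<theta> \<tau> (insert v \<tau>)) = 1"
        by (rule norm_incidence) (use \<tau> vv in \<open>auto simp: mem_link face_iff\<close>)
      moreover have "cmod (\<theta> (insert v \<tau>) (insert v (insert v' \<tau>))) = 1"
        by (rule norm_incidence) (use True vv in \<open>auto simp: mem_link face_iff intro!: exI[of _ v']\<close>)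
      ultimately show ?thesis
        using True weight_pos[of "insert v (insert v' \<tau>)"]
        by (simp add: F_def link_graph_def norm_mult)
    qed (auto simp: F_def link_graph_def)
  next
    show "(\<lambda>v. \<Sum>\<^sub>\<infinity>v'\<in>link X S \<tau>. F v v') summable_on link X S \<tau>"
      using calculation by (rule has_sum_imp_summable)
  qed (assumption, rule link_flow_energy_summable[OF \<tau> \<omega>])
  ultimately have "of_real (m \<tau>) * \<partial> (\<partial> \<omega>) \<tau> = 0" by (metis infsumI)
  then show ?thesis using weight_pos[OF \<tau>] by simp
qed

end

section \<open>The sesquilinear Hodge form\<close>

lemma has_sum_ennreal:
  assumes "(f has_sum s) A" "\<And>x. x \<in> A \<Longrightarrow> 0 \<le> f x"
  shows "((\<lambda>x. ennreal (f x)) has_sum ennreal s) A"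
proof -
  have "((\<lambda>F. ennreal (sum f F)) \<longlongrightarrow> ennreal s) (finite_subsets_at_top A)"
    using assms(1) unfolding has_sum_def by (rule tendsto_ennrealI)
  moreover have "\<forall>\<^sub>F F in finite_subsets_at_top A. ennreal (sum f F) = (\<Sum>x\<in>F. ennreal (f x))"
    by (rule eventually_finite_subsets_at_top_weakI) (use assms(2) in \<open>auto simp: subset_iff sum_ennreal\<close>)
  ultimately show ?thesis
    unfolding has_sum_def by (rule Lim_transform_eventually)
qed

lemma finite_infsum_ennreal:
  fixes f :: "'a \<Rightarrow> real"
  assumes fin: "(\<Sum>\<^sub>\<infinity>x\<in>A. ennreal (f x)) < \<infinity>" and nonneg: "\<And>x. x \<in> A \<Longrightarrow> 0 \<le> f x"
  shows "(f has_sum enn2real (\<Sum>\<^sub>\<infinity>x\<in>A. ennreal (f x))) A"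
proof -
  let ?I = "\<Sum>\<^sub>\<infinity>x\<in>A. ennreal (f x)"
  have "f summable_on A"
  proof (rule nonneg_bdd_above_summable_on)
    show "bdd_above (sum f ` {F. F \<subseteq> A \<and> finite F})"
    proof (rule bdd_aboveI2)
      fix F assume F: "F \<in> {F. F \<subseteq> A \<and> finite F}"
      then have "ennreal (sum f F) = (\<Sum>x\<in>F. ennreal (f x))"
        using nonneg by (subst sum_ennreal) auto
      also have "\<dots> = (\<Sum>\<^sub>\<infinity>x\<in>F. ennreal (f x))" using F by simp
      also have "\<dots> \<le> ?I"
        using F by (intro infsum_mono_neutral nonneg_summable_on_complete) auto
      finally have "enn2real (ennreal (sum f F)) \<le> enn2real ?I"
        using fin by (intro enn2real_mono) auto
      moreover have "0 \<le> sum f F" using F nonneg by (intro sum_nonneg) auto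
      ultimately show "sum f F \<le> enn2real ?I" by simp
    qed
  qed (rule nonneg)
  then have s: "(f has_sum infsum f A) A" by simp
  have "?I = ennreal (infsum f A)" by (rule infsumI[OF has_sum_ennreal[OF s nonneg]])
  moreover have "0 \<le> infsum f A" by (rule infsum_nonneg[OF nonneg])
  ultimately show ?thesis using s by simp
qed

lemma polarization_identity:
  fixes a b :: complex
  shows "of_real ((cmod (a + b))\<^sup>2) - of_real ((cmod (a - b))\<^sup>2)
      + \<i> * of_real ((cmod (a + \<i> * b))\<^sup>2) - \<i> * of_real ((cmod (a - \<i> * b))\<^sup>2) = 4 * (a * cnj b)"
  by (simp add: complex_eq_iff cmod_power2) (simp add: power2_eq_square algebra_simps)

context coboundary_complex
begin

text \<open>
  The Hodge--Dirac operator, whose squared norm is the Hodge form.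
\<close>

definition hodge_dirac :: "'v cochain \<Rightarrow> 'v cochain" where
  "hodge_dirac \<omega> = \<delta> \<omega> + \<partial> \<omega>"

lemma hodge_dirac_lincomb:
  assumes "\<omega> \<in> l2 S m" "\<eta> \<in> l2 S m"
  shows "hodge_dirac (\<omega> + cscale c \<eta>) = hodge_dirac \<omega> + cscale c (hodge_dirac \<eta>)"
  unfolding hodge_dirac_def
  using boundary_lincomb[OF assms[THEN l2_subset_boundary_dom], of c]
    coboundary_lincomb[OF assms[THEN l2_fun_on], of c]
  by (simp add: cfun.scale_right_distrib add_ac)

lemma hodge_dirac_fun_on: "\<omega> \<in> fun_on S \<Longrightarrow> hodge_dirac \<omega> \<in> fun_on S"
  by (simp add: hodge_dirac_def fun_on_def boundary_outside coboundary_outside)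

lemma hodge_form_has_sum:
  assumes "\<omega> \<in> hodge_dom_N S m \<delta>"
  shows "((\<lambda>\<sigma>. m \<sigma> * (cmod (hodge_dirac \<omega> \<sigma>))\<^sup>2) has_sum enn2real (hodge_form S m \<delta> \<omega>)) S"
  using assms weight_pos unfolding hodge_dom_N_def hodge_form_def hodge_dirac_def
  by (auto intro!: finite_infsum_ennreal simp: less_imp_le)

lemma hodge_dirac_l2: "\<omega> \<in> hodge_dom_N S m \<delta> \<Longrightarrow> hodge_dirac \<omega> \<in> l2 S m"
  using has_sum_imp_summable[OF hodge_form_has_sum] hodge_dirac_fun_on
  by (auto simp: l2_def hodge_dom_N_def)

text \<open>
  The polarization identity holds for each simplex. The summands of the four quadratic
  expressions are separately summable because a form domain is a subspace on which the form is finite.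
\<close>

lemma hodge_sesq_has_sum:
  assumes sub: "cfun.subspace DQ" "DQ \<subseteq> hodge_dom_N S m \<delta>" and \<omega>: "\<omega> \<in> DQ" and \<eta>: "\<eta> \<in> DQ"
  shows "((\<lambda>\<sigma>. of_real (m \<sigma>) * hodge_dirac \<omega> \<sigma> * cnj (hodge_dirac \<eta> \<sigma>)) has_sum hodge_sesq S m \<delta> \<omega> \<eta>) S"
proof -
  let ?q = "\<lambda>\<omega>. enn2real (hodge_form S m \<delta> \<omega>)"
  let ?D = hodge_dirac
  have l2: "\<omega> \<in> l2 S m" "\<eta> \<in> l2 S m" using sub \<omega> \<eta> by (auto simp: hodge_dom_N_def)
  have q: "((\<lambda>\<sigma>. complex_of_real (m \<sigma> * (cmod (?D \<omega> \<sigma> + c * ?D \<eta> \<sigma>))\<^sup>2)) has_sum of_real (?q (\<omega> + cscale c \<eta>))) S" for c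
  proof -
    have "\<omega> + cscale c \<eta> \<in> DQ"
      using sub(1) \<omega> \<eta> by (intro cfun.subspace_add cfun.subspace_scale)
    then have "((\<lambda>\<sigma>. m \<sigma> * (cmod (?D (\<omega> + cscale c \<eta>) \<sigma>))\<^sup>2) has_sum ?q (\<omega> + cscale c \<eta>)) S"
      using sub(2) by (intro hodge_form_has_sum) auto
    then show ?thesis
      unfolding hodge_dirac_lincomb[OF l2] by (intro has_sum_of_real) (simp add: cscale_def)
  qed
  have sesq: "hodge_sesq S m \<delta> \<omega> \<eta> = (of_real (?q (\<omega> + cscale 1 \<eta>)) + - of_real (?q (\<omega> + cscale (-1) \<eta>))
      + \<i> * of_real (?q (\<omega> + cscale \<i> \<eta>)) + - (\<i> * of_real (?q (\<omega> + cscale (-\<i>) \<eta>)))) * (1/4)"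
    by (simp add: hodge_sesq_def polarize_def)
  have sum: "((\<lambda>\<sigma>. (complex_of_real (m \<sigma> * (cmod (?D \<omega> \<sigma> + 1 * ?D \<eta> \<sigma>))\<^sup>2)
       + - complex_of_real (m \<sigma> * (cmod (?D \<omega> \<sigma> + (-1) * ?D \<eta> \<sigma>))\<^sup>2)
       + \<i> * complex_of_real (m \<sigma> * (cmod (?D \<omega> \<sigma> + \<i> * ?D \<eta> \<sigma>))\<^sup>2)
       + - (\<i> * complex_of_real (m \<sigma> * (cmod (?D \<omega> \<sigma> + (-\<i>) * ?D \<eta> \<sigma>))\<^sup>2))) * (1/4))
     has_sum (of_real (?q (\<omega> + cscale 1 \<eta>)) + - of_real (?q (\<omega> + cscale (-1) \<eta>))
      + \<i> * of_real (?q (\<omega> + cscale \<i> \<eta>)) + - (\<i> * of_real (?q (\<omega> + cscale (-\<i>) \<eta>)))) * (1/4)) S"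
    by (intro has_sum_cmult_left has_sum_add has_sum_uminusI has_sum_cmult_right q)
  have pointwise: "(complex_of_real (m \<sigma> * (cmod (a + 1 * b))\<^sup>2)
       + - complex_of_real (m \<sigma> * (cmod (a + (-1) * b))\<^sup>2)
       + \<i> * complex_of_real (m \<sigma> * (cmod (a + \<i> * b))\<^sup>2)
       + - (\<i> * complex_of_real (m \<sigma> * (cmod (a + (-\<i>) * b))\<^sup>2))) * (1/4) = of_real (m \<sigma>) * a * cnj b" for \<sigma> a b
    using arg_cong[OF polarization_identity[of a b], of "\<lambda>z. of_real (m \<sigma>) * z / 4"]
    by (simp add: field_simps)
  show ?thesis using sum unfolding pointwise sesq .
qed

text \<open>
  A finitely supported function is approximated by the constant sequence.
\<close>

lemma indicator_in_form_domain:
  assumes "hodge_dom_D S m \<delta> \<subseteq> DQ" "\<tau> \<in> S"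
  shows "indicator {\<tau>} \<in> DQ"
proof -
  let ?\<phi> = "indicator {\<tau>} :: 'v cochain"
  have fin: "?\<phi> \<in> fun_fin S" by (rule indicator_fun_fin[OF assms(2)])
  have 0: "\<delta> 0 \<sigma> = 0" "\<partial> 0 \<sigma> = 0" for \<sigma>
  proof -
    have "(0 :: 'v cochain) \<in> fun_on S" by (simp add: fun_on_def)
    then show "\<delta> 0 \<sigma> = 0"
      by (cases "\<sigma> \<in> S") (simp_all add: coboundary_apply coboundary_outside)
    show "\<partial> 0 \<sigma> = 0" by (simp add: boundary_def)
  qed
  have "hodge_form_norm2 S m \<delta> (?\<phi> - ?\<phi>) = 0"
    by (simp add: hodge_form_norm2_def hodge_form_def l2_norm_def 0)
  then have "?\<phi> \<in> hodge_dom_D S m \<delta>"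
    unfolding hodge_dom_D_def using fin fun_fin_l2[OF fin]
    by (intro CollectI conjI exI[of _ "\<lambda>_. ?\<phi>"]) simp_all
  then show ?thesis using assms(1) by blast
qed

lemma l2_inner_indicator:
  assumes "\<tau> \<in> S"
  shows "l2_inner S m f (indicator {\<tau>}) = of_real (m \<tau>) * f \<tau>"
proof -
  have "((\<lambda>\<sigma>. of_real (m \<sigma>) * f \<sigma> * cnj (indicator {\<tau>} \<sigma>)) has_sum of_real (m \<tau>) * f \<tau>) S"
    by (rule has_sum_finite_neutralI[of "{\<tau>}"]) (use assms in \<open>auto simp: indicator_def\<close>)
  then show ?thesis unfolding l2_inner_def by (rule infsumI)
qed

text \<open>
  The function \<open>D 1\<^sub>\<tau>\<close> is \<open>\<theta>(\<tau>, \<sigma>)\<close> at the cofaces \<open>\<sigma>\<close> of \<open>\<tau>\<close>, \<open>m(\<tau>) \<theta>(\<rho>, \<tau>) / m(\<rho>)\<close> at its faces \<open>\<rho>\<close>, and \<open>0\<close> elsewhere. So the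
  two groups of terms in the pairing with \<open>D \<omega>\<close> are a boundary and a coboundary at \<open>\<tau>\<close>.
\<close>

lemma hodge_sesq_indicator:
  assumes sub: "cfun.subspace DQ" "DQ \<subseteq> hodge_dom_N S m \<delta>" "hodge_dom_D S m \<delta> \<subseteq> DQ"
    and \<omega>: "\<omega> \<in> DQ" and \<tau>: "\<tau> \<in> S"
  shows "hodge_sesq S m \<delta> \<omega> (indicator {\<tau>}) = of_real (m \<tau>) * (\<partial> (hodge_dirac \<omega>) \<tau> + \<delta> (hodge_dirac \<omega>) \<tau>)"
proof -
  let ?D = hodge_dirac
  have ind: "indicator {\<tau>} \<in> DQ" by (rule indicator_in_form_domain[OF sub(3) \<tau>])
  have Dl2: "?D \<omega> \<in> l2 S m" using sub \<omega> by (intro hodge_dirac_l2) auto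
  define t where "t \<sigma> = of_real (m \<sigma>) * ?D \<omega> \<sigma> * cnj (?D (indicator {\<tau>}) \<sigma>)" for \<sigma>
  have t_coface: "t \<sigma> = of_real (m \<sigma>) * \<theta> \<tau> \<sigma> * ?D \<omega> \<sigma>" if "\<sigma> \<in> cofaces S \<tau>" for \<sigma>
  proof -
    have \<sigma>: "\<sigma> \<in> S" "\<tau> \<prec>\<^sub>f \<sigma>" using that by (auto simp: mem_cofaces)
    have "of_real (m \<sigma>) * \<partial> (indicator {\<tau>}) \<sigma> = 0"
      using boundary_indicator[OF \<tau> \<sigma>(1)] face_antisym[OF \<sigma>(2)] by simp
    then have "\<partial> (indicator {\<tau>}) \<sigma> = 0" using weight_pos[OF \<sigma>(1)] by simp
    then show ?thesis
      using that \<sigma> \<tau> by (simp add: t_def hodge_dirac_def coboundary_indicator cnj_incidence)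
  qed
  have t_face: "t \<rho> = of_real (m \<tau>) * (\<theta> \<rho> \<tau> * ?D \<omega> \<rho>)" if "\<rho> \<in> faces S \<tau>" for \<rho>
  proof -
    have \<rho>: "\<rho> \<in> S" "\<rho> \<prec>\<^sub>f \<tau>" using that by (auto simp: mem_faces)
    have "\<rho> \<notin> cofaces S \<tau>" using face_antisym[OF \<rho>(2)] by (simp add: mem_cofaces)
    then have "t \<rho> = ?D \<omega> \<rho> * cnj (of_real (m \<rho>) * \<partial> (indicator {\<tau>}) \<rho>)"
      by (simp add: t_def hodge_dirac_def coboundary_indicator \<tau>)
    also have "\<dots> = ?D \<omega> \<rho> * cnj (of_real (m \<tau>) * \<theta> \<rho> \<tau>)"
      using \<rho> by (simp only: boundary_indicator[OF \<tau> \<rho>(1)] if_True)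
    finally show ?thesis using \<rho> \<tau> by (simp add: cnj_incidence)
  qed
  have t_else: "t \<sigma> = 0" if "\<sigma> \<in> S" "\<sigma> \<notin> cofaces S \<tau>" "\<sigma> \<notin> faces S \<tau>" for \<sigma>
  proof -
    have "of_real (m \<sigma>) * \<partial> (indicator {\<tau>}) \<sigma> = 0"
      using boundary_indicator[OF \<tau> that(1)] that by (simp add: mem_faces)
    then have "\<partial> (indicator {\<tau>}) \<sigma> = 0" using weight_pos[OF that(1)] by simp
    then show ?thesis using that by (simp add: t_def hodge_dirac_def coboundary_indicator \<tau>)
  qed
  have "(t has_sum of_real (m \<tau>) * \<partial> (?D \<omega>) \<tau>) (cofaces S \<tau>)"
    using boundary_has_sum[OF l2_subset_boundary_dom[OF Dl2] \<tau>] t_coface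
    by (subst has_sum_cong[of _ t]) auto
  moreover have "(t has_sum of_real (m \<tau>) * \<delta> (?D \<omega>) \<tau>) (faces S \<tau>)"
    using finite_faces[OF \<tau>] t_face
    by (intro has_sum_finiteI) (auto simp: coboundary_apply[OF l2_fun_on[OF Dl2] \<tau>] sum_distrib_left)
  ultimately have "(t has_sum of_real (m \<tau>) * \<partial> (?D \<omega>) \<tau> + of_real (m \<tau>) * \<delta> (?D \<omega>) \<tau>)
      (cofaces S \<tau> \<union> faces S \<tau>)"
    by (rule has_sum_Un_disjoint) (auto simp: mem_cofaces mem_faces dest: face_antisym)
  moreover have "(t has_sum hodge_sesq S m \<delta> \<omega> (indicator {\<tau>})) S"
    unfolding t_def by (rule hodge_sesq_has_sum[OF sub(1,2) \<omega> ind])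
  then have "(t has_sum hodge_sesq S m \<delta> \<omega> (indicator {\<tau>})) (cofaces S \<tau> \<union> faces S \<tau>)"
    by (subst has_sum_cong_neutral[where T=S and g=t])
       (use t_else in \<open>auto simp: cofaces_def faces_def\<close>)
  ultimately show ?thesis using has_sum_unique by (metis distrib_left)
qed

lemma boundary_in_boundary_dom:
  assumes \<omega>: "\<omega> \<in> hodge_dom_N S m \<delta>" and dom: "\<delta> \<omega> \<in> boundary_dom S m"
  shows "\<partial> \<omega> \<in> boundary_dom S m"
proof -
  have D: "hodge_dirac \<omega> \<in> boundary_dom S m"
    by (rule l2_subset_boundary_dom[OF hodge_dirac_l2[OF \<omega>]])
  have "(\<lambda>\<tau>. m \<tau> * cmod (\<partial> \<omega> \<tau>)) summable_on cofaces S \<rho>" if \<rho>: "\<rho> \<in> S" for \<rho>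
  proof (rule summable_on_comparison_test)
    show "(\<lambda>\<tau>. m \<tau> * cmod (hodge_dirac \<omega> \<tau>) + m \<tau> * cmod (\<delta> \<omega> \<tau>)) summable_on cofaces S \<rho>"
      using D dom \<rho> by (intro summable_on_add) (simp_all add: boundary_dom_def)
    fix \<tau> assume "\<tau> \<in> cofaces S \<rho>"
    then have m: "0 < m \<tau>" by (simp add: mem_cofaces weight_pos)
    then show "0 \<le> m \<tau> * cmod (\<partial> \<omega> \<tau>)" by simp
    have "cmod (\<partial> \<omega> \<tau>) \<le> cmod (hodge_dirac \<omega> \<tau>) + cmod (\<delta> \<omega> \<tau>)"
      using norm_triangle_ineq4[of "hodge_dirac \<omega> \<tau>" "\<delta> \<omega> \<tau>"] by (simp add: hodge_dirac_def)
    then show "m \<tau> * cmod (\<partial> \<omega> \<tau>) \<le> m \<tau> * cmod (hodge_dirac \<omega> \<tau>) + m \<tau> * cmod (\<delta> \<omega> \<tau>)"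
      using m by (simp flip: distrib_left)
  qed
  then show ?thesis using boundary_fun_on by (simp add: boundary_dom_def)
qed

end

theorem theorem5p1:
  fixes X :: "'v set" and S :: "'v set set" and m :: "'v set \<Rightarrow> real"
    and \<delta> :: "'v cochain \<Rightarrow> 'v cochain"
    and DQ DL :: "'v cochain set" and L :: "'v cochain \<Rightarrow> 'v cochain"
  assumes complex: "weighted_simplicial_complex X S m"
    and coboundary: "coboundary_operator S \<delta>"
    and form: "closed_hodge_form S m \<delta> DQ"
    and laplacian: "hodge_laplacian S m \<delta> DQ DL L"
    and recurrent_links:
      "\<forall>\<rho>\<in>S. \<forall>V\<in>graph_components (link X S \<rho>) (link_graph S m \<rho>).
         recurrent V (link_graph S m \<rho>)"
    and boundary_coboundary: "\<forall>\<omega>\<in>fun_fin S. boundary S m \<delta> (\<delta> \<omega>) \<in> l2 S m"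
  shows "\<forall>\<omega>\<in>DL. \<omega> \<in> boundary_dom S m \<and> \<delta> \<omega> \<in> boundary_dom S m \<and>
           L \<omega> = boundary S m \<delta> (\<delta> \<omega>) + \<delta> (boundary S m \<delta> \<omega>)"
proof
  interpret coboundary_complex X S m \<delta> by unfold_locales (fact complex, fact coboundary)
  have sub: "cfun.subspace DQ" "DQ \<subseteq> hodge_dom_N S m \<delta>" "hodge_dom_D S m \<delta> \<subseteq> DQ"
    using form by (auto simp: closed_hodge_form_def)
  fix \<omega> assume "\<omega> \<in> DL"
  then have \<omega>Q: "\<omega> \<in> DQ" and Ll2: "L \<omega> \<in> l2 S m"
    and weak: "\<And>\<eta>. \<eta> \<in> DQ \<Longrightarrow> hodge_sesq S m \<delta> \<omega> \<eta> = l2_inner S m (L \<omega>) \<eta>"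
    using laplacian by (auto simp: hodge_laplacian_def self_adjoint_on_def linear_operator_on_def)
  have \<omega>N: "\<omega> \<in> hodge_dom_N S m \<delta>" and \<omega>l2: "\<omega> \<in> l2 S m" using sub \<omega>Q by (auto simp: hodge_dom_N_def)
  have on: "\<omega> \<in> fun_on S" by (rule l2_fun_on[OF \<omega>l2])
  have dom: "\<omega> \<in> boundary_dom S m" by (rule l2_subset_boundary_dom[OF \<omega>l2])
  have cdom: "\<delta> \<omega> \<in> boundary_dom S m"
    using boundary_coboundary by (intro coboundary_in_boundary_dom[OF \<omega>l2]) (auto intro: indicator_fun_fin)
  have bdom: "\<partial> \<omega> \<in> boundary_dom S m" by (rule boundary_in_boundary_dom[OF \<omega>N cdom])
  have "L \<omega> \<tau> = (\<partial> (\<delta> \<omega>) + \<delta> (\<partial> \<omega>)) \<tau>" for \<tau>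
  proof (cases "\<tau> \<in> S")
    case True
    have Dsum: "hodge_dirac \<omega> = \<delta> \<omega> + cscale 1 (\<partial> \<omega>)" by (simp add: hodge_dirac_def)
    have "\<partial> (\<partial> \<omega>) \<tau> = 0"
      using recurrent_links True by (intro boundary_boundary[OF \<omega>l2 bdom True]) blast
    then have b: "\<partial> (hodge_dirac \<omega>) \<tau> = \<partial> (\<delta> \<omega>) \<tau>"
      unfolding Dsum boundary_lincomb[OF cdom bdom] by simp
    have d: "\<delta> (hodge_dirac \<omega>) = \<delta> (\<partial> \<omega>)"
      unfolding Dsum coboundary_lincomb[OF coboundary_fun_on[OF on] boundary_fun_on]
      by (simp add: coboundary_coboundary[OF on])
    have "of_real (m \<tau>) * L \<omega> \<tau> = hodge_sesq S m \<delta> \<omega> (indicator {\<tau>})"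
      using weak[OF indicator_in_form_domain[OF sub(3) True]] by (simp add: l2_inner_indicator[OF True])
    also have "\<dots> = of_real (m \<tau>) * (\<partial> (hodge_dirac \<omega>) \<tau> + \<delta> (hodge_dirac \<omega>) \<tau>)"
      by (rule hodge_sesq_indicator[OF sub \<omega>Q True])
    finally show ?thesis using weight_pos[OF True] by (simp add: b d)
  next
    case False
    then show ?thesis
      using Ll2 boundary_outside[OF False] coboundary_outside[OF boundary_fun_on False]
      by (simp add: l2_def fun_on_def)
  qed
  then have "L \<omega> = \<partial> (\<delta> \<omega>) + \<delta> (\<partial> \<omega>)" by (rule ext)
  with dom cdom show "\<omega> \<in> boundary_dom S m \<and> \<delta> \<omega> \<in> boundary_dom S m \<and>
      L \<omega> = \<partial> (\<delta> \<omega>) + \<delta> (\<partial> \<omega>)" by blast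
qed

end
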